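(* Let $\mathcal{H}=(C,F,D,G)$ be a hybrid system on $\mathbb{R}^n$ satisfying the Basic Assumptions, let $h:\mathbb{R}^n\to\mathbb{R}^k$ be a continuous function, and let $\Gamma_1\subset h^{-1}(0)$ be a compact set which is strongly forward invariant for $\mathcal{H}$ and such that all solutions from $\Gamma_1$ are complete. If 1) $\mathcal{H}$ is $\Gamma_1$-detectable from $h$, 2) each $x\in\mathcal{S}_{\mathcal{H}}$ is bounded, and 3) all complete $x\in\mathcal{S}_{\mathcal{H}}$ are such that $h(x(t,j))\to0$ as $t+j\to\infty$, $(t,j)\in\mathrm{dom}(x)$, then $\Gamma_1$ is globally attractive for $\mathcal{H}$.
   Context: Notation: $|x|_\Gamma=\inf_{y\in\Gamma}|x-y|$ and, for $c>0$, $B_c(\Gamma)=\{x\in\mathbb{R}^n:|x|_\Gamma<c\}$. Hybrid system: a 4-tuple $\mathcal{H}=(C,F,D,G)$ satisfying the Basic Assumptions: (A1) $C,D$ are closed subsets of $\mathbb{R}^n$; (A2) $F:\mathbb{R}^n\rightrightarrows\mathbb{R}^n$ is a set-valued map that is outer semicontinuous, locally bounded on $C$, with $F(x)$ nonempty and convex for each $x\in C$; (A3) $G:\mathbb{R}^n\rightrightarrows\mathbb{R}^n$ is outer semicontinuous, locally bounded on $D$, with $G(x)$ nonempty for each $x\in D$. Solutions: a hybrid time domain is a subset of $\mathbb{R}_{\ge0}\times\mathbb{N}$ that is a union of infinitely many sets $[t_j,t_{j+1}]\times\{j\}$, $j\in\mathbb{N}$, or of finitely many such sets with the last one of the form $[t_j,t_{j+1}]\times\{j\}$,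 $[t_j,t_{j+1})\times\{j\}$ or $[t_j,\infty)\times\{j\}$, where $0=t_0\le t_1\le\cdots$. A hybrid arc is a function $x:\mathrm{dom}(x)\to\mathbb{R}^n$ on a hybrid time domain such that for each $j$ the map $t\mapsto x(t,j)$ is locally absolutely continuous on $I_j=\{t:(t,j)\in\mathrm{dom}(x)\}$. A solution of $\mathcal{H}$ is a hybrid arc such that: for each $j$ for which $I_j$ has nonempty interior, $\dot x(t,j)\in F(x(t,j))$ for almost all $t\in I_j$ and $x(t,j)\in C$ for all $t\in[\min I_j,\sup I_j)$; and whenever $(t,j),(t,j+1)\in\mathrm{dom}(x)$, $x(t,j)\in D$ and $x(t,j+1)\in G(x(t,j))$. (From a point outside $C\cup D$ the only solution is the trivial one with domain $\{(0,0)\}$.) All solutions considered are maximal (cannot be extended). A solution is complete if its domain is unbounded, and bounded if its range is bounded. $\mathcal{S}_{\mathcal{H}}(x_0)$ is the set of maximal solutions with $x(0,0)=x_0$, $\mathcal{S}_{\mathcal{H}}(U)=\bigcup_{x_0\in U}\mathcal{S}_{\mathcal{H}}(x_0)$, $\mathcal{S}_{\mathcal{H}}=\mathcal{S}_{\mathcal{H}}(\mathbb{R}^n)$, and $\mathrm{rge}(\mathcal{S}_{\mathcal{H}}(U))$ is the union of the ranges of the solutions in $\mathcal{S}_{\mathcal{H}}(U)$. Invariance: $\Gamma$ is strongly forward invariant for $\mathcal{H}$ if $\mathrm{rge}(\mathcal{S}_{\mathcal{H}}(\Gamma))\subset\Gamma$. $\Gamma$ is weakly forward invariant if for every $x_0\in\Gamma$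 there exists a complete $x\in\mathcal{S}_{\mathcal{H}}(x_0)$ such that $x(t,j)\in\Gamma$ for all $(t,j)\in\mathrm{dom}(x)$. Stability notions for a compact set $\Gamma$: $\Gamma$ is stable for $\mathcal{H}$ if for every $\varepsilon>0$ there is $\delta>0$ with $\mathrm{rge}(\mathcal{S}_{\mathcal{H}}(B_\delta(\Gamma)))\subset B_\varepsilon(\Gamma)$. The basin of attraction of $\Gamma$ is the set of points $p\in\mathbb{R}^n$ such that each $x\in\mathcal{S}_{\mathcal{H}}(p)$ is bounded and, if $x$ is complete, $|x(t,j)|_\Gamma\to0$ as $t+j\to\infty$, $(t,j)\in\mathrm{dom}(x)$. $\Gamma$ is globally attractive if its basin of attraction is $\mathbb{R}^n$; globally asymptotically stable if stable and globally attractive. Relative properties: the restriction of $\mathcal{H}$ to a closed set $\Gamma_2$ is $\mathcal{H}|_{\Gamma_2}=(C\cap\Gamma_2,F,D\cap\Gamma_2,G)$. $\Gamma_1\subset\Gamma_2$ has a property relative to $\Gamma_2$ if it has that property for $\mathcal{H}|_{\Gamma_2}$. Detectability: $\mathcal{H}$ is $\Gamma_1$-detectable from $h$ if $\Gamma_1$ is globally asymptotically stable relative to $\Gamma_2$, where $\Gamma_2$ is the maximal weakly forward invariant (for $\mathcal{H}$) subset contained in $h^{-1}(0)$. *)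

theory Defs
  imports "HOL-Analysis.Analysis"
begin

section \<open>Distance to a set\<close>

text \<open>
  The distance is extended-real valued, so that the infimum over the empty set is infinite and
  \<open>dist_ball c {} = {}\<close>. The library's \<^const>\<open>infdist\<close> agrees with it on nonempty sets but
  has value 0 for the empty set.
\<close>

definition set_dist :: "'a::real_normed_vector \<Rightarrow> 'a set \<Rightarrow> ereal" where
  "set_dist x \<Gamma> = (INF y\<in>\<Gamma>. ereal (norm (x - y)))"

definition dist_ball :: "real \<Rightarrow> 'a::real_normed_vector set \<Rightarrow> 'a set" where
  "dist_ball c \<Gamma> = {x. set_dist x \<Gamma> < ereal c}"

lemma set_dist_eq_infdist: "\<Gamma> \<noteq> {} \<Longrightarrow> set_dist x \<Gamma> = ereal (infdist x \<Gamma>)"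
proof -
  assume ne: "\<Gamma> \<noteq> {}"
  have "infdist x \<Gamma> = (INF y\<in>\<Gamma>. dist x y)"
    using ne by (simp add: infdist_def)
  moreover have "ereal (INF y\<in>\<Gamma>. dist x y) = (INF y\<in>\<Gamma>. ereal (dist x y))"
    using ne by (subst ereal_Inf') (auto intro!: bdd_belowI[of _ 0] simp: image_image)
  ultimately show ?thesis
    by (simp add: set_dist_def dist_norm)
qed

section \<open>Hybrid systems\<close>

record 'a hybrid_system =
  flow_set :: "'a set"
  flow_map :: "'a \<Rightarrow> 'a set"
  jump_set :: "'a set"
  jump_map :: "'a \<Rightarrow> 'a set"

definition outer_semicontinuous :: "('a::topological_space \<Rightarrow> 'b::topological_space set) \<Rightarrow> bool" where
  "outer_semicontinuous M \<longleftrightarrow>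
     (\<forall>X Y x y. (\<forall>i::nat. Y i \<in> M (X i)) \<and> X \<longlonglongrightarrow> x \<and> Y \<longlonglongrightarrow> y \<longrightarrow> y \<in> M x)"

definition locally_bounded_on :: "'a set \<Rightarrow> ('a::topological_space \<Rightarrow> 'b::metric_space set) \<Rightarrow> bool" where
  "locally_bounded_on S M \<longleftrightarrow> (\<forall>x\<in>S. \<exists>U. open U \<and> x \<in> U \<and> bounded (\<Union>z\<in>U \<inter> S. M z))"

definition basic_assumptions :: "'a::euclidean_space hybrid_system \<Rightarrow> bool" where
  "basic_assumptions H \<longleftrightarrow>
     closed (flow_set H) \<and> closed (jump_set H) \<and>
     outer_semicontinuous (flow_map H) \<and> locally_bounded_on (flow_set H) (flow_map H) \<and>
     (\<forall>x\<in>flow_set H. flow_map H x \<noteq> {} \<and> convex (flow_map H x)) \<and>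
     outer_semicontinuous (jump_map H) \<and> locally_bounded_on (jump_set H) (jump_map H) \<and>
     (\<forall>x\<in>jump_set H. jump_map H x \<noteq> {})"

definition restrict_system :: "'a hybrid_system \<Rightarrow> 'a set \<Rightarrow> 'a hybrid_system" where
  "restrict_system H S = H\<lparr>flow_set := flow_set H \<inter> S, jump_set := jump_set H \<inter> S\<rparr>"

section \<open>Hybrid arcs\<close>

text \<open>In the half-open case the interval is required to be nonempty, so that every hybrid time
  domain contains \<open>(0, 0)\<close>.\<close>

definition hybrid_time_domain :: "(real \<times> nat) set \<Rightarrow> bool" where
  "hybrid_time_domain E \<longleftrightarrow>
     (\<exists>t. t 0 = 0 \<and> incseq t \<and>
        (E = (\<Union>j. {t j..t (Suc j)} \<times> {j}) \<or>
         (\<exists>J L. E = (\<Union>j<J. {t j..t (Suc j)} \<times> {j}) \<union> L \<times> {J} \<and>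
            (L = {t J..t (Suc J)} \<or> (t J < t (Suc J) \<and> L = {t J..<t (Suc J)}) \<or> L = {t J..}))))"

text \<open>The values of \<open>hval\<close> outside \<open>hdom\<close> are irrelevant.\<close>

record 'a hybrid_arc =
  hdom :: "(real \<times> nat) set"
  hval :: "real \<Rightarrow> nat \<Rightarrow> 'a"

definition absolutely_continuous_on_interval ::
    "real \<Rightarrow> real \<Rightarrow> (real \<Rightarrow> 'a::real_normed_vector) \<Rightarrow> bool" where
  "absolutely_continuous_on_interval a b f \<longleftrightarrow>
     (\<forall>\<epsilon>>0. \<exists>\<delta>>0. \<forall>P. finite P \<and> (\<forall>(u, v)\<in>P. a \<le> u \<and> u \<le> v \<and> v \<le> b) \<and>
        disjoint_family_on (\<lambda>(u, v). {u<..<v}) P \<and> (\<Sum>(u, v)\<in>P. v - u) < \<delta> \<longrightarrow>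
        (\<Sum>(u, v)\<in>P. norm (f v - f u)) < \<epsilon>)"

definition locally_absolutely_continuous_on ::
    "real set \<Rightarrow> (real \<Rightarrow> 'a::real_normed_vector) \<Rightarrow> bool" where
  "locally_absolutely_continuous_on I f \<longleftrightarrow>
     (\<forall>a b. a \<le> b \<and> {a..b} \<subseteq> I \<longrightarrow> absolutely_continuous_on_interval a b f)"

definition htimes :: "'a hybrid_arc \<Rightarrow> nat \<Rightarrow> real set" where
  "htimes x j = {t. (t, j) \<in> hdom x}"

definition hybrid_arc :: "'a::real_normed_vector hybrid_arc \<Rightarrow> bool" where
  "hybrid_arc x \<longleftrightarrow> hybrid_time_domain (hdom x) \<and>
     (\<forall>j. locally_absolutely_continuous_on (htimes x j) (\<lambda>t. hval x t j))"

definition hrange :: "'a hybrid_arc \<Rightarrow> 'a set" where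
  "hrange x = {hval x t j | t j. (t, j) \<in> hdom x}"

definition complete_arc :: "'a hybrid_arc \<Rightarrow> bool" where
  "complete_arc x \<longleftrightarrow> \<not> bounded ((\<lambda>(t, j). (t, real j)) ` hdom x)"

text \<open>The limit \<open>t + j \<rightarrow> \<infinity>\<close> with \<open>(t, j)\<close> in the domain of \<open>x\<close>.\<close>

definition htime_at_top :: "'a hybrid_arc \<Rightarrow> (real \<times> nat) filter" where
  "htime_at_top x = inf (filtercomap (\<lambda>(t, j). t + real j) at_top) (principal (hdom x))"

lemma eventually_htime_at_top:
  "eventually P (htime_at_top x) \<longleftrightarrow> (\<exists>T. \<forall>(t, j)\<in>hdom x. T \<le> t + real j \<longrightarrow> P (t, j))"
  unfolding htime_at_top_def eventually_inf_principal eventually_filtercomap_at_top_linorder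
  by (auto; meson)

section \<open>Solutions\<close>

text \<open>On an interval \<open>I\<close>, the set \<open>{t\<in>I. \<exists>s\<in>I. t < s}\<close> is \<open>[min I, sup I)\<close>.\<close>

definition solution :: "'a::euclidean_space hybrid_system \<Rightarrow> 'a hybrid_arc \<Rightarrow> bool" where
  "solution H x \<longleftrightarrow> hybrid_arc x \<and>
     (\<forall>j. interior (htimes x j) \<noteq> {} \<longrightarrow>
        (AE t in lebesgue. t \<in> htimes x j \<longrightarrow>
           (\<exists>v\<in>flow_map H (hval x t j).
              ((\<lambda>s. hval x s j) has_vector_derivative v) (at t within htimes x j))) \<and>
        (\<forall>t\<in>htimes x j. (\<exists>s\<in>htimes x j. t < s) \<longrightarrow> hval x t j \<in> flow_set H)) \<and>
     (\<forall>t j. (t, j) \<in> hdom x \<and> (t, Suc j) \<in> hdom x \<longrightarrow>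
        hval x t j \<in> jump_set H \<and> hval x t (Suc j) \<in> jump_map H (hval x t j))"

definition maximal_solution :: "'a::euclidean_space hybrid_system \<Rightarrow> 'a hybrid_arc \<Rightarrow> bool" where
  "maximal_solution H x \<longleftrightarrow> solution H x \<and>
     \<not> (\<exists>y. solution H y \<and> hdom x \<subset> hdom y \<and> (\<forall>(t, j)\<in>hdom x. hval y t j = hval x t j))"

definition solutions_from :: "'a::euclidean_space hybrid_system \<Rightarrow> 'a set \<Rightarrow> 'a hybrid_arc set" where
  "solutions_from H U = {x. maximal_solution H x \<and> hval x 0 0 \<in> U}"

definition reach :: "'a::euclidean_space hybrid_system \<Rightarrow> 'a set \<Rightarrow> 'a set" where
  "reach H U = (\<Union>x\<in>solutions_from H U. hrange x)"

section \<open>Invariance, stability and detectability\<close>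

definition strongly_forward_invariant :: "'a::euclidean_space hybrid_system \<Rightarrow> 'a set \<Rightarrow> bool" where
  "strongly_forward_invariant H \<Gamma> \<longleftrightarrow> reach H \<Gamma> \<subseteq> \<Gamma>"

definition weakly_forward_invariant :: "'a::euclidean_space hybrid_system \<Rightarrow> 'a set \<Rightarrow> bool" where
  "weakly_forward_invariant H \<Gamma> \<longleftrightarrow>
     (\<forall>p\<in>\<Gamma>. \<exists>x\<in>solutions_from H {p}. complete_arc x \<and> hrange x \<subseteq> \<Gamma>)"

definition stable :: "'a::euclidean_space hybrid_system \<Rightarrow> 'a set \<Rightarrow> bool" where
  "stable H \<Gamma> \<longleftrightarrow> (\<forall>\<epsilon>>0. \<exists>\<delta>>0. reach H (dist_ball \<delta> \<Gamma>) \<subseteq> dist_ball \<epsilon> \<Gamma>)"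

definition basin_of_attraction :: "'a::euclidean_space hybrid_system \<Rightarrow> 'a set \<Rightarrow> 'a set" where
  "basin_of_attraction H \<Gamma> =
     {p. \<forall>x\<in>solutions_from H {p}. bounded (hrange x) \<and>
           (complete_arc x \<longrightarrow>
              ((\<lambda>(t, j). set_dist (hval x t j) \<Gamma>) \<longlongrightarrow> 0) (htime_at_top x))}"

definition globally_attractive :: "'a::euclidean_space hybrid_system \<Rightarrow> 'a set \<Rightarrow> bool" where
  "globally_attractive H \<Gamma> \<longleftrightarrow> basin_of_attraction H \<Gamma> = UNIV"

definition globally_asymptotically_stable :: "'a::euclidean_space hybrid_system \<Rightarrow> 'a set \<Rightarrow> bool" where
  "globally_asymptotically_stable H \<Gamma> \<longleftrightarrow> stable H \<Gamma> \<and> globally_attractive H \<Gamma>"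

definition maximal_weakly_invariant_subset ::
    "'a::euclidean_space hybrid_system \<Rightarrow> 'a set \<Rightarrow> 'a set" where
  "maximal_weakly_invariant_subset H K = \<Union>{S. S \<subseteq> K \<and> weakly_forward_invariant H S}"

lemma maximal_weakly_invariant_subset_greatest:
  shows "maximal_weakly_invariant_subset H K \<subseteq> K"
    and "weakly_forward_invariant H (maximal_weakly_invariant_subset H K)"
    and "S \<subseteq> K \<Longrightarrow> weakly_forward_invariant H S \<Longrightarrow> S \<subseteq> maximal_weakly_invariant_subset H K"
proof -
  show "weakly_forward_invariant H (maximal_weakly_invariant_subset H K)"
    unfolding weakly_forward_invariant_def
  proof
    fix p assume "p \<in> maximal_weakly_invariant_subset H K"
    then obtain S where S: "S \<subseteq> K" "weakly_forward_invariant H S" "p \<in> S"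
      unfolding maximal_weakly_invariant_subset_def by blast
    then obtain x where "x \<in> solutions_from H {p}" "complete_arc x" "hrange x \<subseteq> S"
      unfolding weakly_forward_invariant_def by blast
    moreover have "S \<subseteq> maximal_weakly_invariant_subset H K"
      using S unfolding maximal_weakly_invariant_subset_def by blast
    ultimately show "\<exists>x\<in>solutions_from H {p}. complete_arc x \<and>
        hrange x \<subseteq> maximal_weakly_invariant_subset H K"
      by blast
  qed
qed (auto simp: maximal_weakly_invariant_subset_def)

definition detectable ::
    "'a::euclidean_space hybrid_system \<Rightarrow> 'a set \<Rightarrow> ('a \<Rightarrow> 'b::real_normed_vector) \<Rightarrow> bool" where
  "detectable H \<Gamma> h \<longleftrightarrow>
     globally_asymptotically_stable
       (restrict_system H (maximal_weakly_invariant_subset H (h -` {0}))) \<Gamma>"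

end

theory Submission
  imports Defs "HOL-Library.Diagonal_Subsequence"
begin

text \<open>
  The \<open>\<omega>\<close>-limit set \<open>\<Omega>\<close> of a bounded complete solution \<open>x\<close> is weakly forward invariant, because
  time shifts of \<open>x\<close> are sequentially compact: limits of solutions are solutions. As
  \<open>h (x(t, j)) \<rightarrow> 0\<close>, \<open>\<Omega>\<close> lies in \<open>h\<^sup>-\<^sup>1(0)\<close> and hence in \<open>\<Gamma>\<^sub>2\<close>, so that limits of shifts of \<open>x\<close> are
  maximal solutions of the restricted system and obey its stability and attractivity. In particular
  \<open>x\<close> comes close to \<open>\<Gamma>\<^sub>1\<close> at arbitrarily large times. If \<open>x\<close> also had distance at least \<open>\<epsilon>\<close> from \<open>\<Gamma>\<^sub>1\<close> at
  arbitrarily large times, shift \<open>x\<close> to the last time before such an excursion at which it is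
  \<open>\<delta>/2\<close>-close to \<open>\<Gamma>\<^sub>1\<close>. The limit of these shifts starts in the \<open>\<delta>\<close>-ball and tends to \<open>\<Gamma>\<^sub>1\<close>, which
  bounds the lengths of the excursions, so it has itself a point at distance at least \<open>\<epsilon>\<close>,
  contradicting stability.

  Compactness of solutions rests on a derivative-free form of the differential inclusion
  (bounds of increments by the support function of the velocity set). Passing to it uses Cousin's
  lemma; passing back uses that Lipschitz functions are differentiable almost everywhere.
\<close>

section \<open>Differentiability of Lipschitz functions almost everywhere\<close>

text \<open>Detectability speaks only of solutions of the restricted system, and \<open>x\<close>
  itself need not stay in \<open>\<Gamma>\<^sub>2\<close>; every use of stability or attraction
  therefore goes through a limit of shifts. Such limits are complete, and complete solutions are
  maximal, which both notions require. Different shifts have different time domains, so convergence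
  needs a common frame. The domain of a complete arc is encoded by its jump times in the extended
  reals, a compact space in which jumps may escape to infinity, and each flow piece is extended to
  the whole real line by constants beyond its ends. Local boundedness of the flow map on a bounded
  range gives one Lipschitz constant for all pieces of all shifts, so convergence of the extensions
  at rational times is enough. Convexity and closedness of the velocity sets are what makes the
  support-function inequalities strong enough to recover the inclusion.\<close>

text \<open>Vitali's covering theorem extracts countably many disjoint intervals of \<open>K\<close>
  that cover \<open>S\<close> up to a null set; a bound valid for all finite disjoint subfamilies
  then passes to \<open>S\<close>. It serves for steep intervals, whose total length is controlled
  by the increment of a function, and for flat ones inside an open set.\<close>

lemma measure_le_of_fine_interval_cover:
  fixes S :: "real set" and K :: "(real \<times> real) set"
  assumes S: "S \<in> lmeasurable"
    and K: "\<And>u v. (u, v) \<in> K \<Longrightarrow> u < v"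
    and cover: "\<And>t d. t \<in> S \<Longrightarrow> 0 < d \<Longrightarrow> \<exists>u v. (u, v) \<in> K \<and> u \<le> t \<and> t \<le> v \<and> v - u < d"
    and bound: "\<And>P. finite P \<Longrightarrow> P \<subseteq> K \<Longrightarrow>
      pairwise (\<lambda>p q. disjnt {fst p..snd p} {fst q..snd q}) P \<Longrightarrow>
      (\<Sum>p\<in>P. measure lebesgue (S \<inter> {fst p..snd p})) \<le> B"
  shows "measure lebesgue S \<le> B"
proof -
  \<comment> \<open>Vitali's theorem is applied to balls; an interval is the ball around its
    midpoint.\<close>
  let ?a = "\<lambda>p::real \<times> real. (fst p + snd p) / 2" and ?r = "\<lambda>p::real \<times> real. (snd p - fst p) / 2"
  let ?I = "\<lambda>p::real \<times> real. {fst p..snd p}"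
  have cb: "cball (?a p) (?r p) = ?I p" for p
    by (auto simp: cball_eq_atLeastAtMost field_simps)
  obtain C where C: "countable C" "C \<subseteq> K"
      and dis: "pairwise (\<lambda>i j. disjnt (cball (?a i) (?r i)) (cball (?a j) (?r j))) C"
      and neg: "negligible (S - (\<Union>i\<in>C. cball (?a i) (?r i)))"
  proof (rule Vitali_covering_theorem_cballs[of K ?r S ?a])
    show "0 < ?r p" if "p \<in> K" for p
      using K[of "fst p" "snd p"] that by simp
    show "\<exists>p. p \<in> K \<and> t \<in> cball (?a p) (?r p) \<and> ?r p < d" if t: "t \<in> S" and d: "0 < d" for t d
    proof -
      obtain u v where "(u, v) \<in> K" "u \<le> t" "t \<le> v" "v - u < d"
        using cover[OF t d] by blast
      then show ?thesis
        using K by (intro exI[of _ "(u, v)"]) (unfold cb, force)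
    qed
  qed
  have neg': "negligible (S - (\<Union>p\<in>C. ?I p))"
    using neg unfolding cb .
  have "measure lebesgue (\<Union>p\<in>C. S \<inter> ?I p) \<le> B"
  proof (rule measure_UN_bound[OF \<open>countable C\<close>])
    show "S \<inter> ?I p \<in> lmeasurable" for p
      using S by (simp add: fmeasurable_Int_fmeasurable)
    show "measure lebesgue (\<Union>p\<in>P. S \<inter> ?I p) \<le> B" if P: "P \<subseteq> C" "finite P" for P
    proof -
      have "measure lebesgue (\<Union>p\<in>P. S \<inter> ?I p) \<le> (\<Sum>p\<in>P. measure lebesgue (S \<inter> ?I p))"
        using S P by (intro measure_UNION_le) (auto simp: fmeasurableD)
      also have "\<dots> \<le> B"
        using P C dis by (intro bound) (auto simp: cb elim: pairwise_subset)
      finally show ?thesis .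
    qed
  qed
  moreover have "measure lebesgue (\<Union>p\<in>C. S \<inter> ?I p) = measure lebesgue S"
    by (rule measure_negligible_symdiff[OF S]) (auto intro: negligible_subset[OF neg'])
  ultimately show ?thesis
    by simp
qed

text \<open>Induction on the number of intervals: the one with the largest right endpoint is split
  off, and the others end before it begins, so the induction hypothesis applies with its left
  endpoint in place of \<open>b\<close>. Gaps between intervals only help, by monotonicity.\<close>

lemma sum_increments_le:
  fixes f :: "real \<Rightarrow> real" and P :: "(real \<times> real) set"
  assumes "mono f" "finite P" "\<And>p. p \<in> P \<Longrightarrow> a \<le> fst p \<and> fst p < snd p \<and> snd p \<le> b"
    and "pairwise (\<lambda>p q. disjnt {fst p..snd p} {fst q..snd q}) P" "a \<le> b"
  shows "(\<Sum>p\<in>P. f (snd p) - f (fst p)) \<le> f b - f a"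
  using assms(2-)
proof (induction "card P" arbitrary: P b)
  case 0
  then show ?case
    using \<open>mono f\<close> by (simp add: monoD)
next
  case (Suc n)
  then have ne: "P \<noteq> {}"
    by auto
  have "Max (snd ` P) \<in> snd ` P"
    using Suc.prems(1) ne by (intro Max_in) auto
  then obtain q where q: "q \<in> P" and q_max: "snd q = Max (snd ` P)"
    by auto
  have max: "snd p \<le> snd q" if "p \<in> P" for p
    unfolding q_max using Suc.prems(1) that by (intro Max_ge) auto
  have left: "snd p \<le> fst q" if "p \<in> P - {q}" for p
  proof (rule ccontr)
    assume "\<not> snd p \<le> fst q"
    then have "snd p \<in> {fst p..snd p} \<inter> {fst q..snd q}"
      using max[of p] that Suc.prems(2)[of p] by auto
    moreover have "disjnt {fst p..snd p} {fst q..snd q}"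
      using Suc.prems(3) that q by (auto simp: pairwise_def)
    ultimately show False
      by (auto simp: disjnt_def)
  qed
  have "(\<Sum>p\<in>P - {q}. f (snd p) - f (fst p)) \<le> f (fst q) - f a"
  proof (rule Suc.hyps(1))
    show "n = card (P - {q})"
      using Suc.hyps(2) q Suc.prems(1) by simp
    show "pairwise (\<lambda>p q. disjnt {fst p..snd p} {fst q..snd q}) (P - {q})"
      using Suc.prems(3) by (rule pairwise_subset) auto
  qed (use Suc.prems q left in auto)
  moreover have "f (snd q) \<le> f b"
    using \<open>mono f\<close> Suc.prems(2)[OF q] by (simp add: monoD)
  ultimately show ?case
    using q Suc.prems(1) by (simp add: sum.remove[of P q])
qed

section \<open>Lebesgue's differentiation argument by steep and flat intervals\<close>

text \<open>A superlevel condition for the upper derivative, phrased with intervals around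
  \<open>t\<close>. Since \<open>t\<close> lies strictly inside them, the set is a countable
  intersection of open sets, hence Borel, for any \<open>f\<close>.\<close>

definition steep_points :: "(real \<Rightarrow> real) \<Rightarrow> real \<Rightarrow> real set" where
  "steep_points f s = {t. \<forall>d>0. \<exists>u v. u < t \<and> t < v \<and> v - u < d \<and> s * (v - u) < f v - f u}"

definition flat_points :: "(real \<Rightarrow> real) \<Rightarrow> real \<Rightarrow> real set" where
  "flat_points f s = {t. \<forall>d>0. \<exists>u v. u < t \<and> t < v \<and> v - u < d \<and> f v - f u < s * (v - u)}"

lemma flat_points_eq: "flat_points f s = steep_points (\<lambda>t. - f t) (- s)"
proof -
  have "f v - f u < s * (v - u) \<longleftrightarrow> - s * (v - u) < - f v - - f u" for u v
    by linarith
  then show ?thesis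
    unfolding flat_points_def steep_points_def by simp
qed

lemma sets_steep_points: "steep_points f s \<in> sets borel"
proof -
  let ?U = "\<lambda>n::nat. \<Union>{{u<..<v} |u v. v - u < 1 / real (Suc n) \<and> s * (v - u) < f v - f u}"
  have "steep_points f s = (\<Inter>n. ?U n)"
  proof (intro subset_antisym subsetI INT_I)
    fix t n assume t: "t \<in> steep_points f s"
    have "0 < 1 / real (Suc n)"
      by simp
    with t obtain u v where "u < t" "t < v" "v - u < 1 / real (Suc n)" "s * (v - u) < f v - f u"
      unfolding steep_points_def by blast
    then show "t \<in> ?U n"
      by (intro UnionI[of "{u<..<v}"]) auto
  next
    fix t assume t: "t \<in> (\<Inter>n. ?U n)"
    show "t \<in> steep_points f s"
      unfolding steep_points_def
    proof (intro CollectI allI impI)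
      fix d :: real assume "0 < d"
      then obtain n where n: "1 / real (Suc n) < d"
        using nat_approx_posE by blast
      have "t \<in> ?U n"
        using t by blast
      then obtain u v where "u < t" "t < v" "v - u < 1 / real (Suc n)" "s * (v - u) < f v - f u"
        by auto
      then show "\<exists>u v. u < t \<and> t < v \<and> v - u < d \<and> s * (v - u) < f v - f u"
        using n less_trans by blast
    qed
  qed
  moreover have "open (?U n)" for n
    by (intro open_Union) auto
  then have "(\<Inter>n. ?U n) \<in> sets borel"
    by (intro sets.countable_INT) (auto simp del: Union_iff intro: borel_open)
  ultimately show ?thesis
    by (simp only:)
qed

text \<open>Disjoint steep intervals in \<open>{a..b}\<close> have total length at most
  \<open>(f b - f a) / s\<close>, because their increments add up to at most
  \<open>f b - f a\<close>; the Vitali bound carries this over to \<open>S\<close>.\<close>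

lemma measure_steep_points_le:
  fixes f :: "real \<Rightarrow> real"
  assumes f: "mono f" and s: "0 < s" and S: "S \<in> sets lebesgue" "S \<subseteq> steep_points f s" and ab: "a \<le> b"
  shows "s * measure lebesgue (S \<inter> {a..b}) \<le> f b - f a"
proof -
  \<comment> \<open>Without the two endpoints, all sufficiently short intervals around a point of
    the set stay inside \<open>{a..b}\<close>.\<close>
  let ?S = "S \<inter> {a<..<b}"
  let ?K = "{(u, v). a \<le> u \<and> u < v \<and> v \<le> b \<and> s * (v - u) < f v - f u}"
  have m: "?S \<in> lmeasurable"
    using fmeasurable_Int_fmeasurable[OF _ S(1), of "{a<..<b}"] by (simp add: Int_commute)
  have "measure lebesgue ?S \<le> (f b - f a) / s"
  proof (rule measure_le_of_fine_interval_cover[OF m, of ?K])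
    fix t d :: real assume t: "t \<in> ?S" and "0 < d"
    then have "0 < min d (min (t - a) (b - t))"
      by auto
    then obtain u v where "u < t" "t < v" "v - u < min d (min (t - a) (b - t))" "s * (v - u) < f v - f u"
      using t S(2) unfolding steep_points_def by blast
    then show "\<exists>u v. (u, v) \<in> ?K \<and> u \<le> t \<and> t \<le> v \<and> v - u < d"
      by (intro exI[of _ u] exI[of _ v]) auto
  next
    fix P assume P: "finite P" "P \<subseteq> ?K" "pairwise (\<lambda>p q. disjnt {fst p..snd p} {fst q..snd q}) P"
    have "(\<Sum>p\<in>P. measure lebesgue (?S \<inter> {fst p..snd p})) \<le> (\<Sum>p\<in>P. (f (snd p) - f (fst p)) / s)"
    proof (rule sum_mono)
      fix p assume "p \<in> P"
      then have p: "fst p < snd p" "s * (snd p - fst p) < f (snd p) - f (fst p)"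
        using P(2) by auto
      have "measure lebesgue (?S \<inter> {fst p..snd p}) \<le> measure lebesgue {fst p..snd p}"
        using m by (intro measure_mono_fmeasurable) (auto simp: fmeasurableD)
      also have "\<dots> \<le> (f (snd p) - f (fst p)) / s"
        using p s by (simp add: field_simps)
      finally show "measure lebesgue (?S \<inter> {fst p..snd p}) \<le> (f (snd p) - f (fst p)) / s" .
    qed
    also have "\<dots> \<le> (f b - f a) / s"
      unfolding sum_divide_distrib[symmetric]
      using sum_increments_le[OF f P(1) _ P(3) ab] P(2) s by (intro divide_right_mono) force+
    finally show "(\<Sum>p\<in>P. measure lebesgue (?S \<inter> {fst p..snd p})) \<le> (f b - f a) / s" .
  qed auto
  moreover have "measure lebesgue (S \<inter> {a..b}) = measure lebesgue ?S"
    by (rule measure_negligible_symdiff[OF m], rule negligible_subset[of "{a, b}"]) auto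
  ultimately show ?thesis
    using s by (simp add: field_simps)
qed

text \<open>Intervals of small slope have total increment at most \<open>r\<close> times their length, while the steep
  points in them need an increment of at least \<open>s\<close> times their measure.\<close>

lemma negligible_flat_Int_steep:
  fixes f :: "real \<Rightarrow> real"
  assumes f: "mono f" and rs: "0 < r" "r < s"
  shows "negligible (flat_points f r \<inter> steep_points f s)"
proof -
  have "negligible (flat_points f r \<inter> steep_points f s \<inter> {- real n..real n})" for n
  proof -
    let ?S = "flat_points f r \<inter> steep_points f s \<inter> {- real n..real n}"
    have S0: "flat_points f r \<inter> steep_points f s \<in> sets lebesgue"
      using sets_steep_points unfolding flat_points_eq by (metis sets.Int sets_completionI_sets sets_lborel)
    then have S: "?S \<in> lmeasurable"
      using fmeasurable_Int_fmeasurable[OF _ S0, of "{- real n..real n}"] by (simp add: Int_commute)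
    \<comment> \<open>The flat intervals are taken inside an open set \<open>G\<close> that exceeds
      \<open>?S\<close> by less than \<open>e\<close> in measure, so their total length is at most
      the measure of \<open>?S\<close> plus \<open>e\<close>. As \<open>r / s < 1\<close>, letting
      \<open>e\<close> tend to 0 forces measure zero.\<close>
    have le: "measure lebesgue ?S \<le> r / s * (measure lebesgue ?S + e)" if e: "0 < e" for e
    proof -
      obtain G where G: "open G" "?S \<subseteq> G" "G - ?S \<in> lmeasurable" "emeasure lebesgue (G - ?S) < ennreal e"
        using sets_lebesgue_outer_open[OF fmeasurableD[OF S] e] by blast
      have Gm: "G \<in> lmeasurable"
        using fmeasurable.Un[OF S G(3)] G(2) by (simp add: Un_absorb1)
      have "measure lebesgue G = measure lebesgue ?S + measure lebesgue (G - ?S)"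
        using measurable_measure_Diff[OF Gm fmeasurableD[OF S] G(2)] by simp
      moreover have "measure lebesgue (G - ?S) < e"
        using G(3,4) e by (simp add: emeasure_eq_measure2 ennreal_less_iff)
      ultimately have mG: "measure lebesgue G \<le> measure lebesgue ?S + e"
        by simp
      let ?K = "{(u, v). u < v \<and> {u..v} \<subseteq> G \<and> f v - f u < r * (v - u)}"
      have "measure lebesgue ?S \<le> r / s * measure lebesgue G"
      proof (rule measure_le_of_fine_interval_cover[OF S, of ?K])
        fix t d :: real assume t: "t \<in> ?S" and d: "0 < d"
        obtain c where c: "0 < c" "cball t c \<subseteq> G"
          using G t open_contains_cball by blast
        have "0 < min c d"
          using c d by simp
        then obtain u v where "u < t" "t < v" "v - u < min c d" "f v - f u < r * (v - u)"
          using t unfolding flat_points_def by blast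
        moreover from this have "{u..v} \<subseteq> cball t c"
          by (auto simp: cball_eq_atLeastAtMost)
        ultimately show "\<exists>u v. (u, v) \<in> ?K \<and> u \<le> t \<and> t \<le> v \<and> v - u < d"
          using c by (intro exI[of _ u] exI[of _ v]) auto
      next
        fix P assume P: "finite P" "P \<subseteq> ?K" "pairwise (\<lambda>p q. disjnt {fst p..snd p} {fst q..snd q}) P"
        have "(\<Sum>p\<in>P. measure lebesgue (?S \<inter> {fst p..snd p})) \<le> (\<Sum>p\<in>P. r / s * measure lebesgue {fst p..snd p})"
        proof (rule sum_mono)
          fix p assume "p \<in> P"
          then have p: "fst p < snd p" "f (snd p) - f (fst p) < r * (snd p - fst p)"
            using P(2) by auto
          have "s * measure lebesgue (?S \<inter> {fst p..snd p}) \<le> f (snd p) - f (fst p)"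
            using p S rs by (intro measure_steep_points_le[OF f]) auto
          with p rs show "measure lebesgue (?S \<inter> {fst p..snd p}) \<le> r / s * measure lebesgue {fst p..snd p}"
            by (simp add: field_simps)
        qed
        also have "\<dots> = r / s * measure lebesgue (\<Union>p\<in>P. {fst p..snd p})"
          using P by (subst measure_UNION') (auto simp: sum_distrib_left)
        also have "(\<Union>p\<in>P. {fst p..snd p}) \<subseteq> G"
          using P(2) by fastforce
        then have "r / s * measure lebesgue (\<Union>p\<in>P. {fst p..snd p}) \<le> r / s * measure lebesgue G"
          using P(1) rs Gm by (intro mult_left_mono measure_mono_fmeasurable) (auto intro!: sets.finite_UN)
        finally show "(\<Sum>p\<in>P. measure lebesgue (?S \<inter> {fst p..snd p})) \<le> r / s * measure lebesgue G" .
      qed auto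
      also have "\<dots> \<le> r / s * (measure lebesgue ?S + e)"
        using mG rs by (intro mult_left_mono) auto
      finally show ?thesis .
    qed
    have "measure lebesgue ?S \<le> r / s * measure lebesgue ?S"
    proof (rule field_le_epsilon)
      fix e :: real assume "0 < e"
      then have "measure lebesgue ?S \<le> r / s * (measure lebesgue ?S + e * s / r)"
        using le[of "e * s / r"] rs by simp
      also have "\<dots> = r / s * measure lebesgue ?S + e"
        using rs by (simp add: distrib_left)
      finally show "measure lebesgue ?S \<le> r / s * measure lebesgue ?S + e" .
    qed
    then have "(s - r) * measure lebesgue ?S \<le> 0"
      using rs by (simp add: field_simps)
    then have "measure lebesgue ?S = 0"
      using rs measure_nonneg[of lebesgue ?S] by (simp add: mult_le_0_iff)
    then show ?thesis
      using S by (simp add: negligible_iff_measure)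
  qed
  then have "negligible (\<Union>n. flat_points f r \<inter> steep_points f s \<inter> {- real n..real n})"
    by (intro negligible_countable_Union) auto
  moreover have "flat_points f r \<inter> steep_points f s = (\<Union>n. flat_points f r \<inter> steep_points f s \<inter> {- real n..real n})"
  proof (intro subset_antisym subsetI)
    fix t assume t: "t \<in> flat_points f r \<inter> steep_points f s"
    obtain n where "\<bar>t\<bar> \<le> real n"
      using real_arch_simple by blast
    then have "t \<in> {- real n..real n}"
      by auto
    then show "t \<in> (\<Union>n. flat_points f r \<inter> steep_points f s \<inter> {- real n..real n})"
      using t by blast
  qed auto
  ultimately show ?thesis
    by simp
qed


text \<open>Ordinary difference quotients use intervals with \<open>t\<close> as an endpoint. By
  continuity such an interval can be widened a little on both sides without losing the strict slope
  inequality.\<close>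

lemma steep_pointsI:
  fixes f :: "real \<Rightarrow> real"
  assumes f: "continuous_on UNIV f"
    and freq: "\<And>d. 0 < d \<Longrightarrow> \<exists>a b. a \<le> t \<and> t \<le> b \<and> a < b \<and> b - a < d \<and> s * (b - a) < f b - f a"
  shows "t \<in> steep_points f s"
  unfolding steep_points_def
proof (intro CollectI allI impI)
  fix d :: real assume "0 < d"
  then obtain a b where ab: "a \<le> t" "t \<le> b" "a < b" "b - a < d" "s * (b - a) < f b - f a"
    using freq by blast
  have cont: "isCont f x" for x
    using f by (simp add: continuous_on_eq_continuous_at)
  have "((\<lambda>\<eta>. f (b + \<eta>) - f (a - \<eta>) - s * (b - a + 2 * \<eta>)) \<longlongrightarrow> f (b + 0) - f (a - 0) - s * (b - a + 2 * 0)) (at_right 0)"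
    using cont by (intro tendsto_intros isCont_tendsto_compose[of _ f]) auto
  then have "\<forall>\<^sub>F \<eta> in at_right 0. 0 < f (b + \<eta>) - f (a - \<eta>) - s * (b - a + 2 * \<eta>)"
    using ab by (intro order_tendstoD) auto
  moreover have "\<forall>\<^sub>F \<eta> in at_right 0. \<eta> \<in> {0<..<(d - (b - a)) / 2}"
    using ab by (intro eventually_at_right_real) auto
  ultimately have "\<forall>\<^sub>F \<eta> in at_right 0. 0 < \<eta> \<and> \<eta> < (d - (b - a)) / 2 \<and> s * (b - a + 2 * \<eta>) < f (b + \<eta>) - f (a - \<eta>)"
    by eventually_elim auto
  then obtain \<eta> where "0 < \<eta>" "\<eta> < (d - (b - a)) / 2" "s * (b - a + 2 * \<eta>) < f (b + \<eta>) - f (a - \<eta>)"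
    using eventually_happens'[OF trivial_limit_at_right_real] by blast
  then show "\<exists>u v. u < t \<and> t < v \<and> v - u < d \<and> s * (v - u) < f v - f u"
    using ab by (intro exI[of _ "a - \<eta>"] exI[of _ "b + \<eta>"]) (auto simp: algebra_simps)
qed

lemma steep_pointsI_quotient:
  fixes f :: "real \<Rightarrow> real"
  assumes f: "continuous_on UNIV f" and freq: "\<exists>\<^sub>F h in at 0. s < (f (t + h) - f t) / h"
  shows "t \<in> steep_points f s"
proof (rule steep_pointsI[OF f])
  fix d :: real assume "0 < d"
  then have "\<forall>\<^sub>F h in at 0. h \<noteq> 0 \<and> \<bar>h\<bar> < d"
    by (auto simp: eventually_at dist_real_def)
  with freq have "\<exists>\<^sub>F h in at 0. s < (f (t + h) - f t) / h \<and> h \<noteq> 0 \<and> \<bar>h\<bar> < d"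
    by (rule frequently_eventually_frequently)
  then obtain h where h: "s < (f (t + h) - f t) / h" "h \<noteq> 0" "\<bar>h\<bar> < d"
    using frequently_ex by blast
  show "\<exists>a b. a \<le> t \<and> t \<le> b \<and> a < b \<and> b - a < d \<and> s * (b - a) < f b - f a"
  proof (cases "0 < h")
    case True
    then show ?thesis
      using h by (intro exI[of _ t] exI[of _ "t + h"]) (auto simp: field_simps)
  next
    case False
    then show ?thesis
      using h by (intro exI[of _ "t + h"] exI[of _ t]) (auto simp: field_simps)
  qed
qed

text \<open>If the lower and upper limits of the difference quotients differ at \<open>t\<close>,
  two rationals separate them, and \<open>t\<close> is flat for the smaller and steep for the larger
  one. Each rational pair contributes only a null set.\<close>

lemma lipschitz_real_differentiable_ae:
  fixes f :: "real \<Rightarrow> real"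
  assumes lip: "\<And>s t. \<bar>f t - f s\<bar> \<le> M * \<bar>t - s\<bar>"
  obtains N where "negligible N" "\<And>t. t \<notin> N \<Longrightarrow> \<exists>D. (f has_real_derivative D) (at t)"
proof
  \<comment> \<open>The linear term makes the function increasing with all slopes between 1 and
    \<open>2 * M + 1\<close>. So the separating rationals are positive, as the measure estimate
    requires, and the limits are finite.\<close>
  define g where "g t = f t + (M + 1) * t" for t
  have slope: "t - s \<le> g t - g s" "g t - g s \<le> (2 * M + 1) * (t - s)" if "s \<le> t" for s t
    using lip[of t s] that by (auto simp: g_def algebra_simps)
  have g_mono: "mono g"
    by (rule monoI) (use slope(1) in fastforce)
  have "continuous_on UNIV f"
    by (intro lipschitz_on_continuous_on[of "\<bar>M\<bar>"] lipschitz_onI)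
      (auto simp: dist_real_def intro!: order_trans[OF lip] mult_right_mono)
  then have g_cont: "continuous_on UNIV g" and g_cont': "continuous_on UNIV (\<lambda>t. - g t)"
    unfolding g_def by (auto intro!: continuous_intros)
  define N where "N = (\<Union>(r, s)\<in>{(r, s). r \<in> \<rat> \<and> s \<in> \<rat> \<and> 0 < r \<and> r < s}. flat_points g r \<inter> steep_points g s)"
  have "countable {(r::real, s). r \<in> \<rat> \<and> s \<in> \<rat> \<and> 0 < r \<and> r < s}"
    by (rule countable_subset[of _ "\<rat> \<times> \<rat>"]) (auto intro: countable_rat)
  then show "negligible N"
    unfolding N_def
    by (intro negligible_countable_Union) (auto intro!: negligible_flat_Int_steep[OF g_mono])
  show "\<exists>D. (f has_real_derivative D) (at t)" if t: "t \<notin> N" for t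
  proof -
    define q where "q h = (g (t + h) - g t) / h" for h
    have q: "1 \<le> q h \<and> q h \<le> 2 * M + 1" if "h \<noteq> 0" for h
    proof (cases "0 < h")
      case True
      then show ?thesis
        using slope[of t "t + h"] by (auto simp: q_def field_simps)
    next
      case False
      then show ?thesis
        using slope[of "t + h" t] that by (auto simp: q_def field_simps)
    qed
    let ?q = "\<lambda>h. ereal (q h)"
    have ev: "\<forall>\<^sub>F h in at 0. (h::real) \<noteq> 0"
      by (simp add: eventually_at_filter)
    have low: "1 \<le> Liminf (at 0) ?q"
      by (rule Liminf_bounded, rule eventually_mono[OF ev]) (use q in auto)
    have up: "Limsup (at 0) ?q \<le> ereal (2 * M + 1)"
      by (rule Limsup_bounded, rule eventually_mono[OF ev]) (use q in auto)
    have "Limsup (at 0) ?q \<le> Liminf (at 0) ?q"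
    proof (rule ccontr)
      assume "\<not> Limsup (at 0) ?q \<le> Liminf (at 0) ?q"
      then obtain r s where rs: "Liminf (at 0) ?q < ereal (real_of_rat r)" "ereal (real_of_rat r) < ereal (real_of_rat s)"
          "ereal (real_of_rat s) < Limsup (at 0) ?q"
        by (metis ereal_dense3 not_le)
      have "1 < ereal (real_of_rat r)"
        using low rs(1) by (rule le_less_trans)
      then have r: "0 < real_of_rat r"
        by (simp add: one_ereal_def)
      have "\<exists>\<^sub>F h in at 0. - real_of_rat r < (- g (t + h) - - g t) / h"
      proof (rule ccontr)
        assume "\<not> ?thesis"
        then have "\<forall>\<^sub>F h in at 0. \<not> - real_of_rat r < (- g (t + h) - - g t) / h"
          by (simp add: not_frequently)
        then have "ereal (real_of_rat r) \<le> Liminf (at 0) ?q"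
          using ev by (intro Liminf_bounded, eventually_elim) (auto simp: q_def diff_divide_distrib)
        with rs(1) show False
          by simp
      qed
      then have "t \<in> flat_points g (real_of_rat r)"
        unfolding flat_points_eq by (rule steep_pointsI_quotient[OF g_cont'])
      moreover have "\<exists>\<^sub>F h in at 0. real_of_rat s < (g (t + h) - g t) / h"
      proof (rule ccontr)
        assume "\<not> ?thesis"
        then have "\<forall>\<^sub>F h in at 0. \<not> real_of_rat s < (g (t + h) - g t) / h"
          by (simp add: not_frequently)
        then have "Limsup (at 0) ?q \<le> ereal (real_of_rat s)"
          by (intro Limsup_bounded, eventually_elim) (auto simp: q_def)
        with rs(3) show False
          by simp
      qed
      then have "t \<in> steep_points g (real_of_rat s)"
        by (rule steep_pointsI_quotient[OF g_cont])
      ultimately show False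
        using t r rs(2) unfolding N_def by auto
    qed
    then have eq: "Liminf (at 0) ?q = Limsup (at 0) ?q"
      using Liminf_le_Limsup[of "at (0::real)" ?q] by (simp add: order_antisym)
    obtain D where D: "Limsup (at 0) ?q = ereal D"
      using low up unfolding eq by (cases "Limsup (at 0) ?q") (auto simp: one_ereal_def)
    have "(?q \<longlongrightarrow> ereal D) (at 0)"
      using eq D by (intro Liminf_eq_Limsup) auto
    then have "(q \<longlongrightarrow> D) (at 0)"
      by simp
    then have "(g has_real_derivative D) (at t)"
      unfolding q_def DERIV_def .
    then have "((\<lambda>t. g t - (M + 1) * t) has_real_derivative D - (M + 1)) (at t)"
      by (auto intro!: derivative_eq_intros)
    then show ?thesis
      by (auto simp: g_def)
  qed
qed

lemma lipschitz_vector_differentiable_ae: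
  fixes f :: "real \<Rightarrow> 'a::euclidean_space"
  assumes lip: "\<And>s t. norm (f t - f s) \<le> M * \<bar>t - s\<bar>"
  obtains N where "negligible N" "\<And>t. t \<notin> N \<Longrightarrow> \<exists>D. (f has_vector_derivative D) (at t)"
proof -
  have "\<exists>N. negligible N \<and> (\<forall>t. t \<notin> N \<longrightarrow> (\<exists>D. ((\<lambda>t. f t \<bullet> b) has_real_derivative D) (at t)))"
    if b: "b \<in> Basis" for b
  proof -
    have "\<bar>f t \<bullet> b - f s \<bullet> b\<bar> \<le> M * \<bar>t - s\<bar>" for s t
      using lip[of t s] Basis_le_norm[OF b, of "f t - f s"] by (simp add: inner_diff_left)
    then show ?thesis
      using lipschitz_real_differentiable_ae[of "\<lambda>t. f t \<bullet> b" M] by metis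
  qed
  then obtain N where N: "\<And>b. b \<in> Basis \<Longrightarrow> negligible (N b)"
      "\<And>b t. b \<in> Basis \<Longrightarrow> t \<notin> N b \<Longrightarrow> \<exists>D. ((\<lambda>t. f t \<bullet> b) has_real_derivative D) (at t)"
    by metis
  show thesis
  proof
    show "negligible (\<Union>b\<in>Basis. N b)"
      using N(1) by (intro negligible_Union) auto
    fix t assume "t \<notin> (\<Union>b\<in>Basis. N b)"
    then have "\<forall>b\<in>Basis. \<exists>D. ((\<lambda>t. f t \<bullet> b) has_real_derivative D) (at t)"
      using N(2) by blast
    from bchoice[OF this] obtain D
      where D: "\<And>b. b \<in> Basis \<Longrightarrow> ((\<lambda>t. f t \<bullet> b) has_real_derivative D b) (at t)"
      by blast
    have "(f has_vector_derivative (\<Sum>b\<in>Basis. D b *\<^sub>R b)) (at t)"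
      using D unfolding has_vector_derivative_def
      by (subst has_derivative_componentwise_within)
         (auto simp: inner_sum_left_Basis has_field_derivative_def mult_commute_abs)
    then show "\<exists>D. (f has_vector_derivative D) (at t)"
      by blast
  qed
qed

section \<open>Absolutely continuous functions\<close>

lemma absolutely_continuous_on_intervalE:
  assumes "absolutely_continuous_on_interval a b f" "0 < e"
  obtains d where "0 < d" "\<And>P. finite P \<Longrightarrow> \<forall>(u, v)\<in>P. a \<le> u \<and> u \<le> v \<and> v \<le> b \<Longrightarrow>
      disjoint_family_on (\<lambda>(u, v). {u<..<v}) P \<Longrightarrow> (\<Sum>(u, v)\<in>P. v - u) < d \<Longrightarrow>
      (\<Sum>(u, v)\<in>P. norm (f v - f u)) < e"
  using assms unfolding absolutely_continuous_on_interval_def by meson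

text \<open>A gauge argument that never integrates the derivative. At tags outside \<open>N\<close>
  the gauge is so small that the increment is at most \<open>c + e\<close> times the length. At tags
  in \<open>N\<close> it is an open set \<open>U\<close> of small measure, so absolute continuity
  bounds the total increment over the intervals with these tags.\<close>

lemma absolutely_continuous_increment_le:
  fixes g :: "real \<Rightarrow> real"
  assumes ab: "a \<le> b" and ac: "absolutely_continuous_on_interval a b g"
    and N: "negligible N"
    and der: "\<And>t. t \<in> {a..b} - N \<Longrightarrow> \<exists>D\<le>c. (g has_real_derivative D) (at t within {a..b})"
  shows "g b - g a \<le> c * (b - a)"
proof (rule field_le_epsilon)
  fix e0 :: real assume "0 < e0"
  \<comment> \<open>The error splits into \<open>e * (b - a)\<close> from the slopes,
    \<open>e\<close> from the variation over intervals tagged in \<open>N\<close>, and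
    \<open>e\<close> from \<open>\<bar>c\<bar>\<close> times their total length, which is less than
    \<open>d\<close>.\<close>
  define e where "e = e0 / (b - a + 2)"
  have e: "0 < e"
    using \<open>0 < e0\<close> ab by (simp add: e_def)
  have "e * (b - a + 2) = e0"
    using ab by (simp add: e_def)
  then have e_eq: "e * (b - a) + e + e = e0"
    by (simp add: algebra_simps)
  obtain d0 where d0: "0 < d0" and ac': "\<And>P. finite P \<Longrightarrow> \<forall>(u, v)\<in>P. a \<le> u \<and> u \<le> v \<and> v \<le> b \<Longrightarrow>
      disjoint_family_on (\<lambda>(u, v). {u<..<v}) P \<Longrightarrow> (\<Sum>(u, v)\<in>P. v - u) < d0 \<Longrightarrow>
      (\<Sum>(u, v)\<in>P. norm (g v - g u)) < e"
    by (rule absolutely_continuous_on_intervalE[OF ac e]) blast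
  define d where "d = min d0 (e / (\<bar>c\<bar> + 1))"
  have d: "0 < d" "d \<le> d0" "\<bar>c\<bar> * d \<le> e"
  proof -
    show "0 < d" "d \<le> d0"
      using d0 e by (auto simp: d_def)
    have "\<bar>c\<bar> * d \<le> (\<bar>c\<bar> + 1) * (e / (\<bar>c\<bar> + 1))"
      using e \<open>0 < d\<close> by (intro mult_mono) (auto simp: d_def)
    then show "\<bar>c\<bar> * d \<le> e"
      by (simp add: add_pos_nonneg)
  qed
  obtain U where U: "open U" "N \<subseteq> U" "U - N \<in> lmeasurable" "emeasure lebesgue (U - N) < ennreal d"
    using sets_lebesgue_outer_open[OF negligible_imp_sets[OF N] d(1)] by blast
  have Um: "U \<in> lmeasurable"
    by (rule lmeasurable_negligible_symdiff[OF U(3)]) (auto intro: negligible_subset[OF N])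
  have "measure lebesgue U = measure lebesgue (U - N)"
    by (rule measure_negligible_symdiff[OF U(3)]) (auto intro: negligible_subset[OF N])
  then have mU: "measure lebesgue U < d"
    using U(3,4) d(1) by (simp add: emeasure_eq_measure2 ennreal_less_iff)
  have "\<exists>r>0. \<forall>u v. t \<in> {a..b} - N \<longrightarrow> {u..v} \<subseteq> ball t r \<inter> {a..b} \<longrightarrow> u \<le> t \<longrightarrow> t \<le> v \<longrightarrow>
      g v - g u \<le> (c + e) * (v - u)" for t
  proof (cases "t \<in> {a..b} - N")
    case True
    then obtain D where D: "D \<le> c" "(g has_real_derivative D) (at t within {a..b})"
      using der by blast
    then have "(g has_derivative (\<lambda>h. h * D)) (at t within {a..b})"
      by (simp add: has_field_derivative_def mult_commute_abs)
    then obtain r where r: "0 < r" "\<And>s. s \<in> {a..b} \<Longrightarrow> \<bar>s - t\<bar> < r \<Longrightarrow>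
        \<bar>g s - g t - (s - t) * D\<bar> \<le> e * \<bar>s - t\<bar>"
      using e unfolding has_derivative_within_alt by (auto simp: dist_real_def)
    have "g v - g u \<le> (c + e) * (v - u)" if "{u..v} \<subseteq> ball t r \<inter> {a..b}" "u \<le> t" "t \<le> v" for u v
    proof -
      have "u \<in> {u..v}" "v \<in> {u..v}"
        using that by auto
      then have uv: "u \<in> ball t r" "u \<in> {a..b}" "v \<in> ball t r" "v \<in> {a..b}"
        using that(1) by blast+
      have "\<bar>g u - g t - (u - t) * D\<bar> \<le> e * (t - u)" "\<bar>g v - g t - (v - t) * D\<bar> \<le> e * (v - t)"
        using r(2)[of u] r(2)[of v] uv that(2,3) by (auto simp: dist_real_def)
      then have "g v - g u \<le> (D + e) * (v - u)"
        by (simp add: abs_le_iff algebra_simps)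
      also have "\<dots> \<le> (c + e) * (v - u)"
        using D that by (intro mult_right_mono) auto
      finally show ?thesis .
    qed
    then show ?thesis
      using r(1) by blast
  qed (auto intro: exI[of _ 1])
  then obtain r where r: "\<And>t. 0 < r t" "\<And>t u v. t \<in> {a..b} - N \<Longrightarrow> {u..v} \<subseteq> ball t (r t) \<inter> {a..b} \<Longrightarrow>
      u \<le> t \<Longrightarrow> t \<le> v \<Longrightarrow> g v - g u \<le> (c + e) * (v - u)"
    by metis
  have "gauge (\<lambda>t. if t \<in> N then U else ball t (r t))"
    using U r(1) unfolding gauge_def by auto
  then obtain p where p: "p tagged_division_of {a..b}" and fine: "(\<lambda>t. if t \<in> N then U else ball t (r t)) fine p"
    using fine_division_exists_real by blast
  have "finite p"
    using p by blast
  have iv: "\<exists>u v. k = {u..v} \<and> u \<le> v \<and> u \<le> x \<and> x \<le> v \<and> a \<le> u \<and> v \<le> b" if xk: "(x, k) \<in> p" for x k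
  proof -
    obtain u v where "k = {u..v}"
      using tagged_division_ofD(4)[OF p xk] by auto
    moreover have "x \<in> k" "k \<subseteq> {a..b}"
      using tagged_division_ofD(2,3)[OF p xk] by auto
    ultimately show ?thesis
      by auto
  qed
  define pN where "pN = {(x, k) \<in> p. x \<in> N \<and> Inf k < Sup k}"
  define I where "I = (\<lambda>(x::real, k::real set). (Inf k, Sup k))"
  have pN: "finite pN" "pN \<subseteq> p"
    using \<open>finite p\<close> by (auto simp: pN_def intro: finite_subset)
  have disj: "{fst (I q)<..<snd (I q)} \<inter> {fst (I q')<..<snd (I q')} = {}" if "q \<in> pN" "q' \<in> pN" "q \<noteq> q'" for q q'
  proof -
    obtain x k x' k' where q: "q = (x, k)" "q' = (x', k')"
      by fastforce
    then have "(x, k) \<in> p" "(x', k') \<in> p"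
      using that pN by auto
    then have "interior k \<inter> interior k' = {}"
      using tagged_division_ofD(5)[OF p] that q by blast
    moreover obtain u v u' v' where "k = {u..v}" "k' = {u'..v'}" "u \<le> v" "u' \<le> v'"
      using iv \<open>(x, k) \<in> p\<close> \<open>(x', k') \<in> p\<close> by meson
    ultimately show ?thesis
      by (simp add: q I_def interior_atLeastAtMost_real)
  qed
  have nondeg: "fst (I q) < snd (I q)" if "q \<in> pN" for q
    using that by (auto simp: pN_def I_def)
  have inj: "inj_on I pN"
  proof (rule inj_onI, rule ccontr)
    fix q q' assume q: "q \<in> pN" "q' \<in> pN" "I q = I q'" "q \<noteq> q'"
    then show False
      using disj[OF q(1,2,4)] nondeg[OF q(1)] by simp
  qed
  have sub: "{fst (I q)<..<snd (I q)} \<subseteq> U" if q_pN: "q \<in> pN" for q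
  proof -
    obtain x k where q: "q = (x, k)" "(x, k) \<in> p" "x \<in> N"
      using q_pN by (auto simp: pN_def)
    then have "k \<subseteq> U"
      using fineD[OF fine q(2)] by simp
    moreover obtain u v where "k = {u..v}" "u \<le> v"
      using iv[OF q(2)] by blast
    ultimately show ?thesis
      using q by (auto simp: I_def)
  qed
  have small: "(\<Sum>(u, v)\<in>I ` pN. v - u) < d"
  proof -
    have "(\<Sum>(u, v)\<in>I ` pN. v - u) = (\<Sum>q\<in>pN. measure lebesgue {fst (I q)<..<snd (I q)})"
      using nondeg by (subst sum.reindex[OF inj]) (auto intro!: sum.cong simp: case_prod_beta less_imp_le)
    also have "\<dots> = measure lebesgue (\<Union>q\<in>pN. {fst (I q)<..<snd (I q)})"
      using pN disj by (subst measure_UNION') (auto simp: pairwise_def disjnt_def)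
    also have "\<dots> \<le> measure lebesgue U"
      using pN sub Um by (intro measure_mono_fmeasurable) (auto intro!: sets.finite_UN)
    finally show ?thesis
      using mU by simp
  qed
  have "(\<Sum>(u, v)\<in>I ` pN. norm (g v - g u)) < e"
  proof (rule ac')
    show "\<forall>(u, v)\<in>I ` pN. a \<le> u \<and> u \<le> v \<and> v \<le> b"
    proof clarify
      fix u v x k assume "(u, v) = I (x, k)" "(x, k) \<in> pN"
      moreover obtain u' v' where "k = {u'..v'}" "u' \<le> x" "x \<le> v'" "a \<le> u'" "v' \<le> b"
        using iv \<open>(x, k) \<in> pN\<close> pN by blast
      ultimately show "a \<le> u \<and> u \<le> v \<and> v \<le> b"
        by (simp add: I_def)
    qed
    show "disjoint_family_on (\<lambda>(u, v). {u<..<v}) (I ` pN)"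
      unfolding disjoint_family_on_def
    proof (intro ballI impI)
      fix i j assume "i \<in> I ` pN" "j \<in> I ` pN" "i \<noteq> j"
      then obtain q q' where q: "q \<in> pN" "q' \<in> pN" "q \<noteq> q'" "i = I q" "j = I q'"
        by blast
      then show "(case i of (u, v) \<Rightarrow> {u<..<v}) \<inter> (case j of (u, v) \<Rightarrow> {u<..<v}) = {}"
        using disj[OF q(1-3)] by (simp add: case_prod_beta)
    qed
  qed (use small d pN in auto)
  then have var: "(\<Sum>q\<in>pN. \<bar>g (snd (I q)) - g (fst (I q))\<bar>) < e"
    by (subst (asm) sum.reindex[OF inj]) (simp add: case_prod_beta o_def)
  have len: "(\<Sum>q\<in>pN. snd (I q) - fst (I q)) < d"
    using small by (subst (asm) sum.reindex[OF inj]) (simp add: case_prod_beta o_def)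
  \<comment> \<open>Every interval is charged \<open>(c + e)\<close> times its length. For tags in
    \<open>N\<close> the correction adds the absolute increment, and \<open>\<bar>c\<bar>\<close>
    times the length makes up for a negative \<open>c\<close>.\<close>
  let ?r = "\<lambda>q. if q \<in> pN then \<bar>g (snd (I q)) - g (fst (I q))\<bar> + \<bar>c\<bar> * (snd (I q) - fst (I q)) else 0"
  have "g b - g a = (\<Sum>q\<in>p. g (snd (I q)) - g (fst (I q)))"
    using additive_tagged_division_1[OF ab p, of g] by (simp add: I_def case_prod_beta)
  also have "\<dots> \<le> (\<Sum>q\<in>p. (c + e) * (snd (I q) - fst (I q)) + ?r q)"
  proof (rule sum_mono)
    fix q assume "q \<in> p"
    then obtain x k where q: "q = (x, k)" "(x, k) \<in> p"
      by (cases q) auto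
    then obtain u v where uv: "k = {u..v}" "u \<le> x" "x \<le> v" "a \<le> u" "v \<le> b"
      using iv by blast
    then have Iq: "I q = (u, v)"
      by (simp add: q I_def)
    show "g (snd (I q)) - g (fst (I q)) \<le> (c + e) * (snd (I q) - fst (I q)) + ?r q"
    proof (cases "x \<in> N")
      case True
      have "0 \<le> e * (v - u) + (c + \<bar>c\<bar>) * (v - u)"
      proof -
        have "0 \<le> c + \<bar>c\<bar>"
          by linarith
        then show ?thesis
          using e uv mult_nonneg_nonneg[of "c + \<bar>c\<bar>" "v - u"] mult_nonneg_nonneg[of e "v - u"] by linarith
      qed
      moreover have "q \<in> pN" if "u < v"
        using True q uv that by (auto simp: pN_def)
      moreover have "u = v" if "\<not> u < v"
        using that uv by simp
      ultimately show ?thesis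
        by (cases "u < v") (auto simp: Iq algebra_simps)
    next
      case False
      then have "k \<subseteq> ball x (r x)"
        using fineD[OF fine q(2)] by simp
      then have "g v - g u \<le> (c + e) * (v - u)"
        using uv False by (intro r(2)[of x]) auto
      moreover have "q \<notin> pN"
        using False q by (auto simp: pN_def)
      ultimately show ?thesis
        by (simp add: Iq)
    qed
  qed
  also have "\<dots> = (c + e) * (\<Sum>q\<in>p. snd (I q) - fst (I q)) + (\<Sum>q\<in>p. ?r q)"
    by (simp add: sum.distrib sum_distrib_left)
  also have "(\<Sum>q\<in>p. snd (I q) - fst (I q)) = b - a"
    using additive_tagged_division_1[OF ab p, of id] by (simp add: I_def case_prod_beta)
  also have "(\<Sum>q\<in>p. ?r q) = (\<Sum>q\<in>pN. \<bar>g (snd (I q)) - g (fst (I q))\<bar>) + \<bar>c\<bar> * (\<Sum>q\<in>pN. snd (I q) - fst (I q))"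
    using pN \<open>finite p\<close>
    by (subst sum.inter_restrict[symmetric]) (auto simp: Int_absorb1 sum.distrib sum_distrib_left)
  also have "\<dots> \<le> e + e"
    using var len d mult_left_mono[of "\<Sum>q\<in>pN. snd (I q) - fst (I q)" d "\<bar>c\<bar>"] by linarith
  finally show "g b - g a \<le> c * (b - a) + e0"
    using e_eq by (simp add: algebra_simps)
qed

lemma absolutely_continuous_on_interval_inner:
  fixes f :: "real \<Rightarrow> 'a::real_inner"
  assumes "absolutely_continuous_on_interval a b f"
  shows "absolutely_continuous_on_interval a b (\<lambda>t. p \<bullet> f t)"
  unfolding absolutely_continuous_on_interval_def
proof (intro allI impI)
  fix e :: real assume e: "0 < e"
  have p: "0 < norm p + 1"
    by (simp add: add_nonneg_pos)
  with e have "0 < e / (norm p + 1)"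
    by simp
  then obtain d where d: "0 < d" "\<And>P. finite P \<Longrightarrow> \<forall>(u, v)\<in>P. a \<le> u \<and> u \<le> v \<and> v \<le> b \<Longrightarrow>
      disjoint_family_on (\<lambda>(u, v). {u<..<v}) P \<Longrightarrow> (\<Sum>(u, v)\<in>P. v - u) < d \<Longrightarrow>
      (\<Sum>(u, v)\<in>P. norm (f v - f u)) < e / (norm p + 1)"
    by (rule absolutely_continuous_on_intervalE[OF assms]) blast
  have "(\<Sum>(u, v)\<in>P. norm (p \<bullet> f v - p \<bullet> f u)) < e"
    if P: "finite P \<and> (\<forall>(u, v)\<in>P. a \<le> u \<and> u \<le> v \<and> v \<le> b) \<and>
      disjoint_family_on (\<lambda>(u, v). {u<..<v}) P \<and> (\<Sum>(u, v)\<in>P. v - u) < d" for P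
  proof -
    have "(\<Sum>(u, v)\<in>P. norm (p \<bullet> f v - p \<bullet> f u)) \<le> (\<Sum>(u, v)\<in>P. (norm p + 1) * norm (f v - f u))"
    proof (rule sum_mono)
      fix q assume "q \<in> P"
      have "norm (p \<bullet> f v - p \<bullet> f u) \<le> (norm p + 1) * norm (f v - f u)" for u v
        using Cauchy_Schwarz_ineq2[of p "f v - f u"] norm_ge_zero[of "f v - f u"]
        unfolding real_norm_def inner_diff_right[symmetric] distrib_right by linarith
      then show "(case q of (u, v) \<Rightarrow> norm (p \<bullet> f v - p \<bullet> f u)) \<le> (case q of (u, v) \<Rightarrow> (norm p + 1) * norm (f v - f u))"
        by (cases q) simp
    qed
    also have "\<dots> = (norm p + 1) * (\<Sum>(u, v)\<in>P. norm (f v - f u))"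
      by (simp add: sum_distrib_left case_prod_beta)
    also have "\<dots> < (norm p + 1) * (e / (norm p + 1))"
      using P p by (intro mult_strict_left_mono d(2)) blast+
    finally show ?thesis
      using p by simp
  qed
  then show "\<exists>d>0. \<forall>P. finite P \<and> (\<forall>(u, v)\<in>P. a \<le> u \<and> u \<le> v \<and> v \<le> b) \<and>
      disjoint_family_on (\<lambda>(u, v). {u<..<v}) P \<and> (\<Sum>(u, v)\<in>P. v - u) < d \<longrightarrow>
      (\<Sum>(u, v)\<in>P. norm (p \<bullet> f v - p \<bullet> f u)) < e"
    using d(1) by blast
qed

lemma absolutely_continuous_on_interval_imp_continuous_on:
  assumes "absolutely_continuous_on_interval a b f"
  shows "continuous_on {a..b} f"
  unfolding continuous_on_iff
proof (intro ballI allI impI)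
  fix x e :: real assume x: "x \<in> {a..b}" and e: "0 < e"
  obtain d where d: "0 < d" "\<And>P. finite P \<Longrightarrow> \<forall>(u, v)\<in>P. a \<le> u \<and> u \<le> v \<and> v \<le> b \<Longrightarrow>
      disjoint_family_on (\<lambda>(u, v). {u<..<v}) P \<Longrightarrow> (\<Sum>(u, v)\<in>P. v - u) < d \<Longrightarrow>
      (\<Sum>(u, v)\<in>P. norm (f v - f u)) < e"
    by (rule absolutely_continuous_on_intervalE[OF assms e]) blast
  have small: "norm (f v - f u) < e" if "a \<le> u" "u \<le> v" "v \<le> b" "v - u < d" for u v
    using d(2)[of "{(u, v)}"] that by (simp add: disjoint_family_on_def)
  have "dist (f y) (f x) < e" if "y \<in> {a..b}" "dist y x < d" for y
    using small[of x y] small[of y x] that x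
    by (cases "x \<le> y") (auto simp: dist_norm dist_real_def norm_minus_commute)
  then show "\<exists>d>0. \<forall>y\<in>{a..b}. dist y x < d \<longrightarrow> dist (f y) (f x) < e"
    using d(1) by blast
qed

lemma lipschitz_imp_absolutely_continuous_on_interval:
  fixes f :: "real \<Rightarrow> 'a::real_normed_vector"
  assumes lip: "\<And>s t. s \<in> {a..b} \<Longrightarrow> t \<in> {a..b} \<Longrightarrow> norm (f t - f s) \<le> M * \<bar>t - s\<bar>" and M: "0 \<le> M"
  shows "absolutely_continuous_on_interval a b f"
  unfolding absolutely_continuous_on_interval_def
proof (intro allI impI)
  fix e :: real assume e: "0 < e"
  have "(\<Sum>(u, v)\<in>P. norm (f v - f u)) < e"
    if P: "finite P" "\<forall>(u, v)\<in>P. a \<le> u \<and> u \<le> v \<and> v \<le> b" "(\<Sum>(u, v)\<in>P. v - u) < e / (M + 1)" for P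
  proof -
    have "(\<Sum>(u, v)\<in>P. norm (f v - f u)) \<le> (\<Sum>(u, v)\<in>P. (M + 1) * (v - u))"
    proof (rule sum_mono)
      fix q assume "q \<in> P"
      then obtain u v where q: "q = (u, v)" "a \<le> u" "u \<le> v" "v \<le> b"
        using P(2) by (cases q) auto
      then have "norm (f v - f u) \<le> (M + 1) * (v - u)"
        using lip[of u v] by (auto simp: distrib_right)
      then show "(case q of (u, v) \<Rightarrow> norm (f v - f u)) \<le> (case q of (u, v) \<Rightarrow> (M + 1) * (v - u))"
        by (simp add: q)
    qed
    also have "\<dots> = (M + 1) * (\<Sum>(u, v)\<in>P. v - u)"
      by (simp add: sum_distrib_left case_prod_beta)
    also have "\<dots> < (M + 1) * (e / (M + 1))"
      using P(3) M by (intro mult_strict_left_mono) auto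
    finally show ?thesis
      using M by simp
  qed
  then show "\<exists>d>0. \<forall>P. finite P \<and> (\<forall>(u, v)\<in>P. a \<le> u \<and> u \<le> v \<and> v \<le> b) \<and>
      disjoint_family_on (\<lambda>(u, v). {u<..<v}) P \<and> (\<Sum>(u, v)\<in>P. v - u) < d \<longrightarrow>
      (\<Sum>(u, v)\<in>P. norm (f v - f u)) < e"
    using e M by (intro exI[of _ "e / (M + 1)"]) auto
qed

section \<open>Time domains of complete arcs\<close>

definition tinterval :: "(nat \<Rightarrow> ereal) \<Rightarrow> nat \<Rightarrow> real set" where
  "tinterval T j = {t. T j \<le> ereal t \<and> ereal t \<le> T (Suc j)}"

text \<open>A value \<open>T (Suc j) = \<infinity>\<close> encodes that the solution flows forever after its \<open>j\<close>-th jump; the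
  intervals of the later indices are then empty.\<close>

definition schedule :: "(nat \<Rightarrow> ereal) \<Rightarrow> bool" where
  "schedule T \<longleftrightarrow> T 0 = 0 \<and> incseq T"

definition schedule_domain :: "(nat \<Rightarrow> ereal) \<Rightarrow> (real \<times> nat) set" where
  "schedule_domain T = {(t, j). t \<in> tinterval T j}"

lemma schedule_nonneg: "schedule T \<Longrightarrow> 0 \<le> T j"
  unfolding schedule_def using incseqD[of T 0 j] by simp

lemma schedule_mono: "schedule T \<Longrightarrow> i \<le> j \<Longrightarrow> T i \<le> T j"
  unfolding schedule_def using incseqD[of T i j] by simp

lemma schedule_finite:
  assumes "schedule T" "T j \<noteq> \<infinity>"
  obtains a where "T j = ereal a" "0 \<le> a"
  using schedule_nonneg[OF assms(1), of j] assms(2) by (cases "T j") auto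

text \<open>If the last interval is bounded, so is the whole domain. What remains is an infinite
  sequence of intervals or a last one of the form \<open>{t J..}\<close>, and both are described by
  a schedule.\<close>

lemma schedule_of_unbounded_domain:
  assumes "hybrid_time_domain E" and unb: "\<not> bounded ((\<lambda>(t, j). (t, real j)) ` E)"
  obtains T where "schedule T" "E = schedule_domain T"
proof -
  obtain t where t: "t 0 = 0" "incseq t" and E: "E = (\<Union>j. {t j..t (Suc j)} \<times> {j}) \<or>
         (\<exists>J L. E = (\<Union>j<J. {t j..t (Suc j)} \<times> {j}) \<union> L \<times> {J} \<and>
            (L = {t J..t (Suc J)} \<or> (t J < t (Suc J) \<and> L = {t J..<t (Suc J)}) \<or> L = {t J..}))"
    using assms(1) unfolding hybrid_time_domain_def by blast
  from E consider (inf) "E = (\<Union>j. {t j..t (Suc j)} \<times> {j})"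
    | (fin) J L where "E = (\<Union>j<J. {t j..t (Suc j)} \<times> {j}) \<union> L \<times> {J}" "L \<subseteq> {t J..t (Suc J)}"
    | (last) J where "E = (\<Union>j<J. {t j..t (Suc j)} \<times> {j}) \<union> {t J..} \<times> {J}"
    by (elim disjE exE conjE) (auto simp: subset_eq)
  then show thesis
  proof cases
    case inf
    show thesis
    proof (rule that)
      show "schedule (\<lambda>j. ereal (t j))"
        using t by (auto simp: schedule_def incseq_def)
      show "E = schedule_domain (\<lambda>j. ereal (t j))"
        unfolding inf schedule_domain_def tinterval_def by auto
    qed
  next
    case fin
    have "(\<lambda>(t, j). (t, real j)) ` E \<subseteq> {0..t (Suc J)} \<times> {0..real J}"
    proof
      fix z assume "z \<in> (\<lambda>(t, j). (t, real j)) ` E"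
      then obtain s j where z: "(s, j) \<in> E" "z = (s, real j)"
        by auto
      then have j: "j \<le> J" "t j \<le> s" "s \<le> t (Suc j)"
        using fin by auto
      moreover have "0 \<le> t j" "t (Suc j) \<le> t (Suc J)"
        using incseqD[OF t(2), of 0 j] incseqD[OF t(2), of "Suc j" "Suc J"] t(1) j by auto
      ultimately show "z \<in> {0..t (Suc J)} \<times> {0..real J}"
        using z by auto
    qed
    moreover have "bounded ({0..t (Suc J)} \<times> {0..real J})"
      by (intro bounded_Times) auto
    ultimately show thesis
      using unb bounded_subset by blast
  next
    case last
    let ?T = "\<lambda>j. if j \<le> J then ereal (t j) else \<infinity>"
    show thesis
    proof (rule that)
      show "schedule ?T"
        using t by (auto simp: schedule_def incseq_def)
      show "E = schedule_domain ?T"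
      proof (intro subset_antisym subsetI)
        fix z assume "z \<in> E"
        then show "z \<in> schedule_domain ?T"
          unfolding last schedule_domain_def tinterval_def by auto
      next
        fix z assume "z \<in> schedule_domain ?T"
        then show "z \<in> E"
          unfolding last schedule_domain_def tinterval_def
          by (auto split: if_splits simp: not_le less_Suc_eq_le)
      qed
    qed
  qed
qed

lemma hybrid_time_domain_schedule:
  assumes T: "schedule T"
  shows "hybrid_time_domain (schedule_domain T)"
proof (cases "\<forall>j. T j \<noteq> \<infinity>")
  case True
  then have "\<exists>t. T j = ereal t" for j
    using schedule_finite[OF T] by metis
  then obtain t where t: "\<And>j. T j = ereal (t j)"
    by metis
  have "t 0 = 0" "incseq t"
    using T by (auto simp: schedule_def incseq_def t zero_ereal_def)
  moreover have "schedule_domain T = (\<Union>j. {t j..t (Suc j)} \<times> {j})"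
    unfolding schedule_domain_def tinterval_def t by auto
  ultimately show ?thesis
    unfolding hybrid_time_domain_def by blast
next
  case False
  define K where "K = (LEAST j. T j = \<infinity>)"
  have K: "T K = \<infinity>"
    unfolding K_def using False LeastI_ex[of "\<lambda>j. T j = \<infinity>"] by simp
  have before: "T j \<noteq> \<infinity>" if "j < K" for j
    using not_less_Least[of j "\<lambda>j. T j = \<infinity>"] that unfolding K_def by blast
  have after: "T j = \<infinity>" if "K \<le> j" for j
    using schedule_mono[OF T that] K by simp
  have "K \<noteq> 0"
    using T K by (intro notI) (simp add: schedule_def)
  then obtain J where J: "K = Suc J"
    using not0_implies_Suc by blast
  define t where "t j = real_of_ereal (T (min j J))" for j
  have Tt: "T j = ereal (t j)" if "j \<le> J" for j
  proof -
    have "T j \<noteq> \<infinity>"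
      using before[of j] that by (simp add: J)
    then obtain a where "T j = ereal a"
      using schedule_finite[OF T] by metis
    then show ?thesis
      using that by (simp add: t_def)
  qed
  have "t 0 = 0"
    using Tt[of 0] T by (simp add: schedule_def zero_ereal_def)
  moreover have "incseq t"
  proof (rule incseq_SucI)
    fix j
    have "ereal (t (min j J)) \<le> ereal (t (min (Suc j) J))"
      using schedule_mono[OF T, of "min j J" "min (Suc j) J"] Tt[of "min j J"] Tt[of "min (Suc j) J"] by simp
    then show "t j \<le> t (Suc j)"
      by (simp add: t_def)
  qed
  moreover have "schedule_domain T = (\<Union>j<J. {t j..t (Suc j)} \<times> {j}) \<union> {t J..} \<times> {J}"
  proof -
    have "s \<in> tinterval T j \<longleftrightarrow> (j < J \<and> t j \<le> s \<and> s \<le> t (Suc j)) \<or> (j = J \<and> t J \<le> s)" for s j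
    proof -
      consider "j < J" | "j = J" | "J < j"
        by linarith
      then show ?thesis
      proof cases
        case 1
        then show ?thesis
          by (simp add: tinterval_def Tt)
      next
        case 2
        then show ?thesis
          by (simp add: tinterval_def Tt after J)
      next
        case 3
        then show ?thesis
          by (simp add: tinterval_def after J)
      qed
    qed
    then show ?thesis
      unfolding schedule_domain_def by auto
  qed
  ultimately show ?thesis
    unfolding hybrid_time_domain_def by blast
qed

lemma schedule_domain_exhausts:
  assumes T: "schedule T"
  shows "\<exists>(t, j)\<in>schedule_domain T. B \<le> t + real j"
proof (cases "\<forall>j. T j \<noteq> \<infinity>")
  case True
  define j where "j = nat \<lceil>B\<rceil>"
  obtain a where a: "T j = ereal a" "0 \<le> a"
    using schedule_finite[OF T] True by metis
  have "B \<le> real j"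
    unfolding j_def by (rule real_nat_ceiling_ge)
  then show ?thesis
    using a schedule_mono[OF T, of j "Suc j"]
    by (intro bexI[of _ "(a, j)"]) (auto simp: schedule_domain_def tinterval_def)
next
  case False
  define K where "K = (LEAST j. T j = \<infinity>)"
  have K: "T K = \<infinity>"
    unfolding K_def using False LeastI_ex[of "\<lambda>j. T j = \<infinity>"] by simp
  have "K \<noteq> 0"
    using T K by (intro notI) (simp add: schedule_def)
  then obtain J where J: "K = Suc J"
    using not0_implies_Suc by blast
  then have "T J \<noteq> \<infinity>"
    using not_less_Least[of J "\<lambda>j. T j = \<infinity>"] unfolding K_def by simp
  then obtain a where a: "T J = ereal a"
    using schedule_finite[OF T] by metis
  show ?thesis
    using a K J by (intro bexI[of _ "(max a B, J)"]) (auto simp: schedule_domain_def tinterval_def)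
qed

lemma unbounded_schedule_domain:
  assumes T: "schedule T"
  shows "\<not> bounded ((\<lambda>(t, j). (t, real j)) ` schedule_domain T)"
proof
  assume "bounded ((\<lambda>(t, j). (t, real j)) ` schedule_domain T)"
  then obtain B where "\<forall>z\<in>schedule_domain T. norm (case z of (t, j) \<Rightarrow> (t, real j)) \<le> B"
    unfolding bounded_iff by auto
  then have B: "norm (t, real j) \<le> B" if "(t, j) \<in> schedule_domain T" for t j
    using that by fastforce
  obtain t j where tj: "(t, j) \<in> schedule_domain T" "2 * B + 1 \<le> t + real j"
    using schedule_domain_exhausts[OF T, of "2 * B + 1"] by auto
  have "\<bar>t\<bar> \<le> B" "\<bar>real j\<bar> \<le> B"
    using B[OF tj(1)] norm_fst_le[of t "real j"] norm_snd_le[of "real j" t] by auto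
  with tj(2) show False
    by linarith
qed

text \<open>A finite jump time of \<open>S\<close> belongs to the domain with both neighbouring
  indices, which bounds \<open>T (Suc j)\<close> from both sides. An infinite one leaves arbitrarily
  late times with index \<open>j\<close>. Hence an unbounded time domain has no proper
  extension.\<close>

lemma schedule_domain_subset_imp_eq:
  assumes S: "schedule S" and T: "schedule T" and sub: "schedule_domain S \<subseteq> schedule_domain T"
  shows "S = T"
proof
  fix j show "S j = T j"
  proof (induction j)
    case 0
    then show ?case
      using S T by (simp add: schedule_def)
  next
    case (Suc j)
    have in_T: "T j \<le> ereal t \<and> ereal t \<le> T (Suc j)" if "S j \<le> ereal t" "ereal t \<le> S (Suc j)" for t j
      using sub that unfolding schedule_domain_def tinterval_def by blast
    show ?case
    proof (cases "S (Suc j)")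
      case (real b)
      have "S (Suc j) \<le> T (Suc j)"
        using in_T[of j b] real schedule_mono[OF S, of j "Suc j"] by simp
      moreover have "T (Suc j) \<le> S (Suc j)"
        using in_T[of "Suc j" b] real schedule_mono[OF S, of "Suc j" "Suc (Suc j)"] by simp
      ultimately show ?thesis
        by simp
    next
      case PInf
      have "T (Suc j) = \<infinity>"
      proof (cases "S j = \<infinity>")
        case True
        then show ?thesis
          using Suc schedule_mono[OF T, of j "Suc j"] by simp
      next
        case False
        then obtain a where a: "S j = ereal a"
          using schedule_finite[OF S] by metis
        have "ereal r \<le> T (Suc j)" for r
          using in_T[of j "max a r"] PInf a by (auto intro: order_trans[rotated])
        then show ?thesis
          by (rule ereal_top)
      qed
      then show ?thesis
        using PInf by simp
    next
      case MInf
      then show ?thesis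
        using schedule_nonneg[OF S, of "Suc j"] by simp
    qed
  qed
qed

text \<open>Limits of shifts are constructed as complete solutions, whereas invariance, stability
  and attraction quantify over maximal ones; this closes the gap, for the restricted system as
  well.\<close>

lemma complete_solution_maximal:
  assumes x: "solution H x" "complete_arc x"
  shows "maximal_solution H x"
  unfolding maximal_solution_def
proof (intro conjI x(1) notI)
  assume "\<exists>y. solution H y \<and> hdom x \<subset> hdom y \<and> (\<forall>(t, j)\<in>hdom x. hval y t j = hval x t j)"
  then obtain y where y: "solution H y" "hdom x \<subset> hdom y"
    by blast
  have dom: "hybrid_time_domain (hdom x)" "hybrid_time_domain (hdom y)"
    using x(1) y(1) by (auto simp: solution_def hybrid_arc_def)
  have unb: "\<not> bounded ((\<lambda>(t, j). (t, real j)) ` hdom x)"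
    using x(2) by (simp add: complete_arc_def)
  then have unb': "\<not> bounded ((\<lambda>(t, j). (t, real j)) ` hdom y)"
    using y(2) by (meson bounded_subset image_mono psubset_imp_subset)
  obtain S where S: "schedule S" "hdom x = schedule_domain S"
    using schedule_of_unbounded_domain[OF dom(1) unb] .
  obtain T where T: "schedule T" "hdom y = schedule_domain T"
    using schedule_of_unbounded_domain[OF dom(2) unb'] .
  show False
    using schedule_domain_subset_imp_eq[OF S(1) T(1)] y(2) S(2) T(2) by auto
qed

section \<open>Derivative-free form of solutions\<close>

lemma locally_bounded_on_compact:
  assumes "locally_bounded_on S M" "compact K" "K \<subseteq> S"
  shows "bounded (\<Union>z\<in>K. M z)"
proof -
  obtain U where U: "\<And>x. x \<in> S \<Longrightarrow> open (U x) \<and> x \<in> U x \<and> bounded (\<Union>z\<in>U x \<inter> S. M z)"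
    using assms(1) unfolding locally_bounded_on_def by metis
  obtain D where D: "D \<subseteq> K" "finite D" "K \<subseteq> (\<Union>x\<in>D. U x)"
  proof (rule compactE_image[OF assms(2), of K U])
    show "K \<subseteq> (\<Union>x\<in>K. U x)"
      using U assms(3) by blast
  qed (use U assms(3) in blast)+
  have "bounded (\<Union>x\<in>D. \<Union>z\<in>U x \<inter> S. M z)"
    using D U assms(3) by (intro bounded_UN) auto
  then show ?thesis
    by (rule bounded_subset) (use D assms(3) in blast)
qed

lemma basic_assumptionsD:
  assumes "basic_assumptions H"
  shows "closed (flow_set H)" "closed (jump_set H)"
    and "outer_semicontinuous (flow_map H)" "outer_semicontinuous (jump_map H)"
    and "locally_bounded_on (flow_set H) (flow_map H)"
    and "\<And>x. x \<in> flow_set H \<Longrightarrow> convex (flow_map H x)"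
  using assms unfolding basic_assumptions_def by auto

lemma outer_semicontinuousD:
  assumes "outer_semicontinuous M" "\<And>n. Y n \<in> M (X n)" "X \<longlonglongrightarrow> x" "Y \<longlonglongrightarrow> y"
  shows "y \<in> M x"
  using assms unfolding outer_semicontinuous_def by blast

lemma outer_semicontinuous_closed: "outer_semicontinuous M \<Longrightarrow> closed (M (x::'a::first_countable_topology) :: 'b::first_countable_topology set)"
  unfolding closed_sequential_limits by (auto intro: outer_semicontinuousD[of M _ "\<lambda>_. x"])

lemma flow_map_bounded_on_cball:
  assumes H: "basic_assumptions (H :: 'a::euclidean_space hybrid_system)"
  shows "\<exists>M\<ge>0. \<forall>z\<in>flow_set H. norm z \<le> R \<longrightarrow> (\<forall>w\<in>flow_map H z. norm w \<le> M)"
proof -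
  have "compact (flow_set H \<inter> cball 0 R)"
    using basic_assumptionsD(1)[OF H] by (simp add: closed_Int_compact)
  then have "bounded (\<Union>z\<in>flow_set H \<inter> cball 0 R. flow_map H z)"
    using locally_bounded_on_compact[OF basic_assumptionsD(5)[OF H]] by blast
  then obtain M where M: "0 < M" "\<forall>w\<in>(\<Union>z\<in>flow_set H \<inter> cball 0 R. flow_map H z). norm w \<le> M"
    unfolding bounded_pos by blast
  show ?thesis
    by (rule exI[of _ M]) (use M in auto)
qed

text \<open>Local boundedness gives a convergent subsequence of the velocities, and outer
  semicontinuity puts its limit into \<open>flow_map H x\<close>. In contrapositive form this is
  upper semicontinuity of the support function: a strict bound on \<open>p \<bullet> w\<close> at
  \<open>x\<close> persists at nearby points of the flow set.\<close>

lemma flow_map_support_limit: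
  assumes H: "basic_assumptions (H :: 'a::euclidean_space hybrid_system)"
    and X: "\<And>n. X n \<in> flow_set H" "X \<longlonglongrightarrow> x"
    and W: "\<And>n. W n \<in> flow_map H (X n)" "\<And>n. c \<le> p \<bullet> W n"
  obtains w where "w \<in> flow_map H x" "c \<le> p \<bullet> w"
proof -
  have "bounded (range X)"
    using X(2) convergent_imp_bounded by blast
  then obtain R where R: "\<And>n. norm (X n) \<le> R"
    unfolding bounded_iff by auto
  obtain M where "\<forall>z\<in>flow_set H. norm z \<le> R \<longrightarrow> (\<forall>w\<in>flow_map H z. norm w \<le> M)"
    using flow_map_bounded_on_cball[OF H, of R] by metis
  then have "norm (W n) \<le> M" for n
    using X(1)[of n] R[of n] W(1)[of n] by blast
  then have "bounded (range W)"
    unfolding bounded_iff by auto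
  then obtain w r where r: "strict_mono r" "(W \<circ> r) \<longlonglongrightarrow> w"
    using bounded_imp_convergent_subsequence by blast
  show thesis
  proof
    have "(W \<circ> r) n \<in> flow_map H ((X \<circ> r) n)" for n
      using W(1) by simp
    then show "w \<in> flow_map H x"
      using LIMSEQ_subseq_LIMSEQ[OF X(2) r(1)] r(2)
      by (rule outer_semicontinuousD[OF basic_assumptionsD(3)[OF H]])
    have "(\<lambda>n. p \<bullet> (W \<circ> r) n) \<longlonglongrightarrow> p \<bullet> w"
      using r(2) by (intro tendsto_inner tendsto_const)
    then show "c \<le> p \<bullet> w"
      by (rule LIMSEQ_le_const) (use W(2) in auto)
  qed
qed

text \<open>A bounded complete solution, with the differential inclusion replaced by the equivalent
  family of support-function inequalities; unlike the derivative these survive pointwise limits.\<close>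

definition trajectory :: "'a::euclidean_space hybrid_system \<Rightarrow> real \<Rightarrow> real \<Rightarrow> (nat \<Rightarrow> ereal) \<Rightarrow>
    (nat \<Rightarrow> real \<Rightarrow> 'a) \<Rightarrow> bool" where
  "trajectory H M R T g \<longleftrightarrow> schedule T \<and>
     (\<forall>j. \<forall>t\<in>tinterval T j. norm (g j t) \<le> R) \<and>
     (\<forall>j. \<forall>s\<in>tinterval T j. \<forall>t\<in>tinterval T j. norm (g j t - g j s) \<le> M * \<bar>t - s\<bar>) \<and>
     (\<forall>j. \<forall>t\<in>tinterval T j. T j < T (Suc j) \<longrightarrow> g j t \<in> flow_set H) \<and>
     (\<forall>j t. T (Suc j) = ereal t \<longrightarrow> g j t \<in> jump_set H \<and> g (Suc j) t \<in> jump_map H (g j t)) \<and>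
     (\<forall>j. \<forall>s\<in>tinterval T j. \<forall>t\<in>tinterval T j. \<forall>p c. s < t \<longrightarrow>
        (\<forall>u\<in>{s..t}. \<forall>w\<in>flow_map H (g j u). p \<bullet> w \<le> c) \<longrightarrow> p \<bullet> (g j t - g j s) \<le> c * (t - s))"

lemma trajectoryD:
  assumes "trajectory H M R T g"
  shows "schedule T"
    and "\<And>j t. t \<in> tinterval T j \<Longrightarrow> norm (g j t) \<le> R"
    and "\<And>j s t. s \<in> tinterval T j \<Longrightarrow> t \<in> tinterval T j \<Longrightarrow> norm (g j t - g j s) \<le> M * \<bar>t - s\<bar>"
    and "\<And>j t. t \<in> tinterval T j \<Longrightarrow> T j < T (Suc j) \<Longrightarrow> g j t \<in> flow_set H"
    and "\<And>j t. T (Suc j) = ereal t \<Longrightarrow> g j t \<in> jump_set H"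
    and "\<And>j t. T (Suc j) = ereal t \<Longrightarrow> g (Suc j) t \<in> jump_map H (g j t)"
    and "\<And>j s t p c. s \<in> tinterval T j \<Longrightarrow> t \<in> tinterval T j \<Longrightarrow> s < t \<Longrightarrow>
        (\<And>u w. u \<in> {s..t} \<Longrightarrow> w \<in> flow_map H (g j u) \<Longrightarrow> p \<bullet> w \<le> c) \<Longrightarrow> p \<bullet> (g j t - g j s) \<le> c * (t - s)"
  using assms unfolding trajectory_def by blast+

lemma tinterval_convex: "s \<in> tinterval T j \<Longrightarrow> t \<in> tinterval T j \<Longrightarrow> {s..t} \<subseteq> tinterval T j"
  unfolding tinterval_def by (auto intro: order_trans[of "T j" "ereal s"] order_trans[of _ "ereal t"])

lemma tinterval_less:
  assumes "s \<in> tinterval T j" "t \<in> tinterval T j" "s < t"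
  shows "T j < T (Suc j)"
proof -
  have "T j \<le> ereal s" "ereal t \<le> T (Suc j)"
    using assms by (auto simp: tinterval_def)
  moreover have "ereal s < ereal t"
    using assms(3) by simp
  ultimately show ?thesis
    by order
qed

section \<open>From the differential inclusion to support-function inequalities\<close>

lemma solution_absolutely_continuous:
  assumes "solution H x" "{a..b} \<subseteq> htimes x j" "a \<le> b"
  shows "absolutely_continuous_on_interval a b (\<lambda>u. hval x u j)"
  using assms unfolding solution_def hybrid_arc_def locally_absolutely_continuous_on_def by blast

text \<open>The scalar function \<open>p \<bullet> hval x u j\<close> is absolutely continuous, and
  almost everywhere its derivative is \<open>p \<bullet> v\<close> for an admissible velocity
  \<open>v\<close>, hence at most \<open>c\<close>.\<close>

lemma solution_increment_le:
  assumes x: "solution H x" and dom: "hdom x = schedule_domain T"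
    and st: "s \<in> tinterval T j" "t \<in> tinterval T j" "s < t"
    and le: "\<And>u w. u \<in> {s..t} \<Longrightarrow> w \<in> flow_map H (hval x u j) \<Longrightarrow> p \<bullet> w \<le> c"
  shows "p \<bullet> (hval x t j - hval x s j) \<le> c * (t - s)"
proof -
  have ht: "htimes x j = tinterval T j"
    by (auto simp: htimes_def dom schedule_domain_def)
  have sub: "{s..t} \<subseteq> tinterval T j"
    using tinterval_convex[OF st(1,2)] .
  have "{s<..<t} \<subseteq> interior (htimes x j)"
    using sub unfolding ht by (intro interior_maximal) auto
  moreover have "(s + t) / 2 \<in> {s<..<t}"
    using st(3) by auto
  ultimately have int: "interior (htimes x j) \<noteq> {}"
    by blast
  have "AE u in lebesgue. u \<in> htimes x j \<longrightarrow> (\<exists>v\<in>flow_map H (hval x u j).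
      ((\<lambda>s. hval x s j) has_vector_derivative v) (at u within htimes x j))"
    using x int unfolding solution_def by blast
  then obtain N where N: "N \<in> null_sets lebesgue" "{u \<in> space lebesgue. \<not> (u \<in> htimes x j \<longrightarrow>
      (\<exists>v\<in>flow_map H (hval x u j). ((\<lambda>s. hval x s j) has_vector_derivative v) (at u within htimes x j)))} \<subseteq> N"
    unfolding eventually_ae_filter by blast
  have "absolutely_continuous_on_interval s t (\<lambda>u. hval x u j)"
    using sub st(3) by (intro solution_absolutely_continuous[OF x]) (auto simp: ht)
  then have "absolutely_continuous_on_interval s t (\<lambda>u. p \<bullet> hval x u j)"
    by (rule absolutely_continuous_on_interval_inner)
  then have "p \<bullet> hval x t j - p \<bullet> hval x s j \<le> c * (t - s)"
  proof (rule absolutely_continuous_increment_le[rotated])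
    show "negligible N"
      using N(1) by (simp add: negligible_iff_null_sets)
    fix u assume u: "u \<in> {s..t} - N"
    then have "u \<in> htimes x j"
      using sub ht by auto
    then obtain v where v: "v \<in> flow_map H (hval x u j)"
        "((\<lambda>s. hval x s j) has_vector_derivative v) (at u within htimes x j)"
      using N(2) u by auto
    have "((\<lambda>s. hval x s j) has_vector_derivative v) (at u within {s..t})"
      using has_vector_derivative_within_subset[OF v(2)] sub ht by simp
    then have "((\<lambda>s. p \<bullet> hval x s j) has_real_derivative p \<bullet> v) (at u within {s..t})"
      unfolding has_vector_derivative_def has_field_derivative_def
      by (auto dest!: has_derivative_inner_right[of _ _ _ p] simp: mult_commute_abs)
    then show "\<exists>D\<le>c. ((\<lambda>s. p \<bullet> hval x s j) has_real_derivative D) (at u within {s..t})"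
      using le[of u v] u v(1) by auto
  qed (use st(3) in auto)
  then show ?thesis
    by (simp add: inner_diff_right)
qed

text \<open>The definition of a solution omits the right end of a flow interval; continuity and
  closedness of the flow set supply it.\<close>

lemma solution_in_flow_set:
  assumes H: "basic_assumptions H" and x: "solution H x" and dom: "hdom x = schedule_domain T"
    and t: "t \<in> tinterval T j" and less: "T j < T (Suc j)" and T: "schedule T"
  shows "hval x t j \<in> flow_set H"
proof -
  have ht: "htimes x j = tinterval T j"
    by (auto simp: htimes_def dom schedule_domain_def)
  obtain a where a: "T j = ereal a"
    using schedule_finite[OF T, of j] less by fastforce
  have aT: "a \<in> tinterval T j"
    using a less by (auto simp: tinterval_def)
  \<comment> \<open>If \<open>t\<close> is the left end of its interval, a later time is used
    instead, so that \<open>{a..b}\<close> is nondegenerate and contains \<open>t\<close> in any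
    case.\<close>
  obtain b where b: "b \<in> tinterval T j" "a < b" "t \<le> b"
  proof (cases "a < t")
    case True
    then show thesis
      using that[of t] t by simp
  next
    case False
    then have "t = a"
      using t a by (simp add: tinterval_def)
    obtain b where "T j < ereal b" "ereal b < T (Suc j)"
      using ereal_dense2[OF less] by blast
    then show thesis
      using that[of b] a \<open>t = a\<close> by (auto simp: tinterval_def)
  qed
  have sub: "{a..b} \<subseteq> tinterval T j"
    using tinterval_convex[OF aT b(1)] .
  have "{a<..<b} \<subseteq> interior (htimes x j)"
    using sub unfolding ht by (intro interior_maximal) auto
  moreover have "(a + b) / 2 \<in> {a<..<b}"
    using b(2) by auto
  ultimately have "interior (htimes x j) \<noteq> {}"
    by blast
  then have C: "hval x u j \<in> flow_set H" if "u \<in> htimes x j" "v \<in> htimes x j" "u < v" for u v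
    using x that unfolding solution_def by blast
  have "absolutely_continuous_on_interval a b (\<lambda>u. hval x u j)"
    using sub b(2) by (intro solution_absolutely_continuous[OF x]) (auto simp: ht)
  then have cont: "continuous_on {a..b} (\<lambda>u. hval x u j)"
    by (rule absolutely_continuous_on_interval_imp_continuous_on)
  have cl: "closure {a..<b} = {a..b}"
    using b(2) by simp
  have "(\<lambda>u. hval x u j) ` closure {a..<b} \<subseteq> flow_set H"
  proof (rule image_closure_subset)
    show "continuous_on (closure {a..<b}) (\<lambda>u. hval x u j)"
      using cont cl by simp
    show "closed (flow_set H)"
      using basic_assumptionsD(1)[OF H] .
    show "(\<lambda>u. hval x u j) ` {a..<b} \<subseteq> flow_set H"
      using C[of _ b] sub b(1,2) ht by (auto simp: subset_eq)
  qed
  moreover have "t \<in> {a..b}"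
    using t a b by (auto simp: tinterval_def)
  ultimately show ?thesis
    unfolding cl by blast
qed

lemma complete_solution_trajectory:
  assumes H: "basic_assumptions H" and x: "solution H x" "complete_arc x" "bounded (hrange x)"
  obtains M R T where "0 \<le> M" "hdom x = schedule_domain T" "trajectory H M R T (\<lambda>j t. hval x t j)"
proof -
  have "hybrid_time_domain (hdom x)" "\<not> bounded ((\<lambda>(t, j). (t, real j)) ` hdom x)"
    using x by (auto simp: solution_def hybrid_arc_def complete_arc_def)
  then obtain T where T: "schedule T" "hdom x = schedule_domain T"
    by (rule schedule_of_unbounded_domain)
  have dom: "(t, j) \<in> hdom x \<longleftrightarrow> t \<in> tinterval T j" for t j
    by (simp add: T(2) schedule_domain_def)
  obtain R where "\<And>z. z \<in> hrange x \<Longrightarrow> norm z \<le> R"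
    using x(3) unfolding bounded_iff by auto
  then have R: "norm (hval x t j) \<le> R" if "t \<in> tinterval T j" for t j
    using that dom unfolding hrange_def by blast
  obtain M where M: "0 \<le> M" "\<forall>z\<in>flow_set H. norm z \<le> R \<longrightarrow> (\<forall>w\<in>flow_map H z. norm w \<le> M)"
    using flow_map_bounded_on_cball[OF H, of R] by metis
  note C = solution_in_flow_set[OF H x(1) T(2) _ _ T(1)]
  note inc = solution_increment_le[OF x(1) T(2)]
  have lip1: "norm (hval x t j - hval x s j) \<le> M * (t - s)"
    if st: "s \<in> tinterval T j" "t \<in> tinterval T j" "s < t" for s t j
  proof -
    \<comment> \<open>The support inequality is tested in the direction of the increment itself:
      with \<open>M\<close> bounding the velocities it gives
      \<open>norm ?d ^ 2 \<le> norm ?d * M * (t - s)\<close>, and one factor cancels.\<close>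
    let ?d = "hval x t j - hval x s j"
    have "?d \<bullet> ?d \<le> (norm ?d * M) * (t - s)"
    proof (rule inc[OF st])
      fix u w assume u: "u \<in> {s..t}" and w: "w \<in> flow_map H (hval x u j)"
      have "u \<in> tinterval T j"
        using u tinterval_convex[OF st(1,2)] by blast
      then have "norm w \<le> M"
        using M(2) C tinterval_less[OF st] R w by blast
      then show "?d \<bullet> w \<le> norm ?d * M"
        by (meson mult_left_mono norm_cauchy_schwarz norm_ge_zero order_trans)
    qed
    then have "norm ?d * norm ?d \<le> norm ?d * (M * (t - s))"
      by (simp add: dot_square_norm power2_eq_square mult.assoc)
    then show ?thesis
      using M(1) st(3) by (cases "norm ?d = 0") (simp_all add: mult_le_cancel_left)
  qed
  have lip: "norm (hval x t j - hval x s j) \<le> M * \<bar>t - s\<bar>"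
    if st: "s \<in> tinterval T j" "t \<in> tinterval T j" for s t j
    using lip1[of s j t] lip1[of t j s] st
    by (cases s t rule: linorder_cases) (auto simp: norm_minus_commute)
  have jump: "hval x t j \<in> jump_set H \<and> hval x t (Suc j) \<in> jump_map H (hval x t j)"
    if t: "T (Suc j) = ereal t" for t j
  proof -
    have "(t, j) \<in> hdom x" "(t, Suc j) \<in> hdom x"
      using t schedule_mono[OF T(1), of j "Suc j"] schedule_mono[OF T(1), of "Suc j" "Suc (Suc j)"]
      by (auto simp: dom tinterval_def)
    then show ?thesis
      using x(1) unfolding solution_def by blast
  qed
  have "trajectory H M R T (\<lambda>j t. hval x t j)"
    unfolding trajectory_def using T(1) R lip C jump inc by blast
  then show thesis
    using that M(1) T(2) by blast
qed

section \<open>From support-function inequalities back to the differential inclusion\<close>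

definition clip :: "ereal \<Rightarrow> ereal \<Rightarrow> real \<Rightarrow> real" where
  "clip a b t = real_of_ereal (max a (min (ereal t) b))"

lemma clip:
  assumes "0 \<le> a" "a \<le> b" "a \<noteq> \<infinity>"
  shows "a \<le> ereal (clip a b t)" "ereal (clip a b t) \<le> b" "\<bar>clip a b t - clip a b s\<bar> \<le> \<bar>t - s\<bar>"
    and "a \<le> ereal t \<Longrightarrow> ereal t \<le> b \<Longrightarrow> clip a b t = t"
proof -
  obtain a' where a: "a = ereal a'"
    using assms by (cases a) auto
  have "a \<le> ereal (clip a b t) \<and> ereal (clip a b t) \<le> b \<and> \<bar>clip a b t - clip a b s\<bar> \<le> \<bar>t - s\<bar> \<and>
      (a \<le> ereal t \<longrightarrow> ereal t \<le> b \<longrightarrow> clip a b t = t)"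
  proof (cases b)
    case (real b')
    then have "clip a b u = max a' (min u b')" for u
      by (simp add: clip_def a flip: ereal_min ereal_max)
    then show ?thesis
      using assms real a by auto
  next
    case PInf
    then have "clip a b u = max a' u" for u
      by (simp add: clip_def a flip: ereal_max)
    then show ?thesis
      using PInf a by auto
  qed (use assms in auto)
  then show "a \<le> ereal (clip a b t)" "ereal (clip a b t) \<le> b" "\<bar>clip a b t - clip a b s\<bar> \<le> \<bar>t - s\<bar>"
    and "a \<le> ereal t \<Longrightarrow> ereal t \<le> b \<Longrightarrow> clip a b t = t"
    by auto
qed

text \<open>A total extension of each flow piece, constant beyond both ends of its interval, so that
  the Lipschitz constant is kept and pieces with different domains can be compared pointwise. For an
  index that is never reached the default 0 is Lipschitz as well.\<close>

definition clipped :: "(nat \<Rightarrow> ereal) \<Rightarrow> (nat \<Rightarrow> real \<Rightarrow> 'a::zero) \<Rightarrow> nat \<Rightarrow> real \<Rightarrow> 'a" where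
  "clipped T g j t = (if T j = \<infinity> then 0 else g j (clip (T j) (T (Suc j)) t))"

lemma clip_tinterval:
  assumes "schedule T" "T j \<noteq> \<infinity>"
  shows "clip (T j) (T (Suc j)) t \<in> tinterval T j"
  using clip(1,2)[of "T j" "T (Suc j)"] schedule_nonneg[OF assms(1)] schedule_mono[OF assms(1), of j "Suc j"] assms(2)
  by (simp add: tinterval_def)

lemma clipped_eq: "schedule T \<Longrightarrow> t \<in> tinterval T j \<Longrightarrow> clipped T g j t = g j t"
  using clip(4)[of "T j" "T (Suc j)" t] schedule_nonneg[of T j] schedule_mono[of T j "Suc j"]
  by (auto simp: clipped_def tinterval_def)

lemma clipped_lipschitz:
  assumes g: "trajectory H M R T g" and M: "0 \<le> M"
  shows "norm (clipped T g j t - clipped T g j s) \<le> M * \<bar>t - s\<bar>"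
proof (cases "T j = \<infinity>")
  case True
  then show ?thesis
    using M by (simp add: clipped_def)
next
  case False
  note T = trajectoryD(1)[OF g]
  have "norm (clipped T g j t - clipped T g j s) \<le>
      M * \<bar>clip (T j) (T (Suc j)) t - clip (T j) (T (Suc j)) s\<bar>"
    using trajectoryD(3)[OF g clip_tinterval clip_tinterval] T False by (simp add: clipped_def)
  also have "\<dots> \<le> M * \<bar>t - s\<bar>"
    using M clip(3) schedule_nonneg[OF T] schedule_mono[OF T, of j "Suc j"] False
    by (intro mult_left_mono) auto
  finally show ?thesis .
qed

text \<open>A derivative outside the closed convex velocity set is strictly separated from it by a
  hyperplane, so that \<open>p \<bullet> w < c < p \<bullet> v\<close> for all \<open>w\<close> in
  that set. The bound \<open>p \<bullet> w \<le> c\<close> persists at nearby times, so increments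
  to the right of \<open>t\<close> give \<open>p \<bullet> v \<le> c\<close>, a
  contradiction.\<close>

lemma trajectory_derivative_in_flow_map:
  assumes H: "basic_assumptions H" and g: "trajectory H M R T g"
    and t: "T j < ereal t" "ereal t < T (Suc j)"
    and v: "(clipped T g j has_vector_derivative v) (at t)"
  shows "v \<in> flow_map H (g j t)"
proof (rule ccontr)
  note T = trajectoryD(1)[OF g]
  have tI: "t \<in> tinterval T j" and less: "T j < T (Suc j)"
    using t by (auto simp: tinterval_def)
  have C: "g j t \<in> flow_set H"
    using trajectoryD(4)[OF g tI less] .
  assume "v \<notin> flow_map H (g j t)"
  then obtain a b where ab: "a \<bullet> v < b" "\<And>w. w \<in> flow_map H (g j t) \<Longrightarrow> b < a \<bullet> w"
    using separating_hyperplane_closed_point[of "flow_map H (g j t)" v]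
      basic_assumptionsD(6)[OF H C] outer_semicontinuous_closed[OF basic_assumptionsD(3)[OF H]] by blast
  define p c where "p = - a" and "c = - b"
  have p: "c < p \<bullet> v" "\<And>w. w \<in> flow_map H (g j t) \<Longrightarrow> p \<bullet> w < c"
    using ab by (auto simp: p_def c_def)
  have "\<exists>d>0. \<forall>u\<in>tinterval T j. \<bar>u - t\<bar> < d \<longrightarrow> (\<forall>w\<in>flow_map H (g j u). p \<bullet> w \<le> c)"
  proof (rule ccontr)
    assume contr: "\<not> ?thesis"
    have "\<exists>u w. u \<in> tinterval T j \<and> \<bar>u - t\<bar> < inverse (real (Suc n)) \<and> w \<in> flow_map H (g j u) \<and> c < p \<bullet> w" for n
    proof -
      have "0 < inverse (real (Suc n))"
        by simp
      with contr show ?thesis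
        by (meson not_le)
    qed
    then obtain U W where U: "\<And>n. U n \<in> tinterval T j" "\<And>n. \<bar>U n - t\<bar> < inverse (real (Suc n))"
        and W: "\<And>n. W n \<in> flow_map H (g j (U n))" "\<And>n. c < p \<bullet> W n"
      by metis
    have Ulim: "(\<lambda>n. \<bar>U n - t\<bar>) \<longlonglongrightarrow> 0"
      by (rule tendsto_sandwich[OF _ _ tendsto_const LIMSEQ_inverse_real_of_nat])
        (use U(2) in \<open>auto intro!: always_eventually less_imp_le\<close>)
    have "(\<lambda>n. g j (U n) - g j t) \<longlonglongrightarrow> 0"
    proof (rule Lim_null_comparison)
      show "\<forall>\<^sub>F n in sequentially. norm (g j (U n) - g j t) \<le> M * \<bar>U n - t\<bar>"
        using trajectoryD(3)[OF g tI U(1)] by (intro always_eventually allI)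
      show "(\<lambda>n. M * \<bar>U n - t\<bar>) \<longlonglongrightarrow> 0"
        using tendsto_mult_right_zero[OF Ulim] by simp
    qed
    then have "(\<lambda>n. g j (U n)) \<longlonglongrightarrow> g j t"
      by (rule LIM_zero_cancel)
    then show False
    proof (rule flow_map_support_limit[OF H, of "\<lambda>n. g j (U n)" _ W c p, rotated])
      show "g j (U n) \<in> flow_set H" for n
        using trajectoryD(4)[OF g U(1) less] .
    qed (use W p(2) in \<open>auto intro: less_imp_le simp: not_le[symmetric]\<close>)
  qed
  then obtain d where d: "0 < d" "\<And>u w. u \<in> tinterval T j \<Longrightarrow> \<bar>u - t\<bar> < d \<Longrightarrow> w \<in> flow_map H (g j u) \<Longrightarrow> p \<bullet> w \<le> c"
    by blast
  obtain b where b: "ereal t < ereal b" "ereal b < T (Suc j)"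
    using ereal_dense2[OF t(2)] by blast
  have "((\<lambda>s. p \<bullet> clipped T g j s) has_real_derivative p \<bullet> v) (at t)"
    using v unfolding has_vector_derivative_def has_field_derivative_def
    by (auto dest!: has_derivative_inner_right[of _ _ _ p] simp: mult_commute_abs)
  then have "((\<lambda>h. (p \<bullet> clipped T g j (t + h) - p \<bullet> clipped T g j t) / h) \<longlongrightarrow> p \<bullet> v) (at 0)"
    by (simp add: DERIV_def)
  then have lim: "((\<lambda>h. (p \<bullet> clipped T g j (t + h) - p \<bullet> clipped T g j t) / h) \<longlongrightarrow> p \<bullet> v) (at_right 0)"
    by (rule filterlim_mono) (auto simp: at_le)
  have "\<forall>\<^sub>F h in at_right 0. h \<in> {0<..<min d (b - t)}"
    using d(1) b(1) by (intro eventually_at_right_real) auto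
  then have "\<forall>\<^sub>F h in at_right 0. (p \<bullet> clipped T g j (t + h) - p \<bullet> clipped T g j t) / h \<le> c"
  proof eventually_elim
    case (elim h)
    then have h: "0 < h" "h < d" "t + h < b"
      by auto
    have th: "t + h \<in> tinterval T j"
    proof -
      have "T j \<le> ereal (t + h)"
        using t(1) h(1) by (meson ereal_less_eq(3) less_add_same_cancel1 less_imp_le order_trans)
      moreover have "ereal (t + h) \<le> T (Suc j)"
        using b(2) h(3) by (meson ereal_less_eq(3) less_imp_le order_trans)
      ultimately show ?thesis
        by (simp add: tinterval_def)
    qed
    have "p \<bullet> (g j (t + h) - g j t) \<le> c * (t + h - t)"
    proof (rule trajectoryD(7)[OF g tI th])
      fix u w assume u: "u \<in> {t..t + h}" "w \<in> flow_map H (g j u)"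
      show "p \<bullet> w \<le> c"
        using tinterval_convex[OF tI th] u h by (intro d(2)[of u]) auto
    qed (use h in auto)
    then show ?case
      using h clipped_eq[OF T th, of g] clipped_eq[OF T tI, of g] by (simp add: inner_diff_right field_simps)
  qed
  then have "p \<bullet> v \<le> c"
    using tendsto_upperbound[OF lim] by simp
  with p(1) show False
    by simp
qed

definition schedule_arc :: "(nat \<Rightarrow> ereal) \<Rightarrow> (nat \<Rightarrow> real \<Rightarrow> 'a) \<Rightarrow> 'a hybrid_arc" where
  "schedule_arc T g = \<lparr>hdom = schedule_domain T, hval = (\<lambda>t j. g j t)\<rparr>"

lemma schedule_arc_simps [simp]:
  "hdom (schedule_arc T g) = schedule_domain T"
  "hval (schedule_arc T g) t j = g j t"
  "htimes (schedule_arc T g) j = tinterval T j"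
  by (auto simp: schedule_arc_def htimes_def schedule_domain_def)

text \<open>The Lipschitz extension of each piece is differentiable off a null set, and the
  hyperplane argument identifies its derivative as an admissible velocity. Completeness is immediate
  from the schedule.\<close>

lemma trajectory_solution:
  assumes H: "basic_assumptions H" and g: "trajectory H M R T g" and M: "0 \<le> M"
  shows "solution H (schedule_arc T g)" "complete_arc (schedule_arc T g)"
proof -
  note T = trajectoryD(1)[OF g]
  show "complete_arc (schedule_arc T g)"
    using unbounded_schedule_domain[OF T] by (simp add: complete_arc_def)
  have arc: "hybrid_arc (schedule_arc T g)"
    unfolding hybrid_arc_def locally_absolutely_continuous_on_def
  proof (intro conjI allI impI)
    show "hybrid_time_domain (hdom (schedule_arc T g))"
      using hybrid_time_domain_schedule[OF T] by simp
    fix j and a b :: real assume "a \<le> b \<and> {a..b} \<subseteq> htimes (schedule_arc T g) j"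
    then have "{a..b} \<subseteq> tinterval T j"
      by simp
    then have "absolutely_continuous_on_interval a b (g j)"
      using trajectoryD(3)[OF g] M by (intro lipschitz_imp_absolutely_continuous_on_interval[of a b _ M]) blast+
    then show "absolutely_continuous_on_interval a b (\<lambda>t. hval (schedule_arc T g) t j)"
      by simp
  qed
  have flow: "AE t in lebesgue. t \<in> tinterval T j \<longrightarrow>
      (\<exists>v\<in>flow_map H (g j t). (g j has_vector_derivative v) (at t within tinterval T j))" for j
  proof -
    obtain N where N: "negligible N" "\<And>t. t \<notin> N \<Longrightarrow> \<exists>D. (clipped T g j has_vector_derivative D) (at t)"
      using lipschitz_vector_differentiable_ae[OF clipped_lipschitz[OF g M, of j]] by blast
    \<comment> \<open>At the ends of the interval the extension may have a corner, so they join the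
      null set. An infinite end becomes 0 under \<open>real_of_ereal\<close>, which only excludes
      one more point.\<close>
    let ?E = "{real_of_ereal (T j), real_of_ereal (T (Suc j))}"
    have "negligible (N \<union> ?E)"
      using N(1) by simp
    moreover have "\<exists>v\<in>flow_map H (g j t). (g j has_vector_derivative v) (at t within tinterval T j)"
      if t: "t \<in> tinterval T j" "t \<notin> N \<union> ?E" for t
    proof -
      obtain v where v: "(clipped T g j has_vector_derivative v) (at t)"
        using N(2) t by blast
      have "T j \<noteq> ereal t" "T (Suc j) \<noteq> ereal t"
        using t(2) by auto
      then have "T j < ereal t" "ereal t < T (Suc j)"
        using t(1) by (auto simp: tinterval_def less_le)
      then have "v \<in> flow_map H (g j t)"
        using trajectory_derivative_in_flow_map[OF H g _ _ v] by blast
      moreover have "(g j has_vector_derivative v) (at t within tinterval T j)"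
        using has_vector_derivative_transform[OF t(1) _ has_vector_derivative_at_within[OF v], of "g j"]
          clipped_eq[OF T, of _ j g] by simp
      ultimately show ?thesis
        by blast
    qed
    ultimately show ?thesis
      unfolding eventually_ae_filter negligible_iff_null_sets by blast
  qed
  show "solution H (schedule_arc T g)"
    unfolding solution_def
  proof (intro conjI allI impI arc ballI)
    fix j
    show "AE t in lebesgue. t \<in> htimes (schedule_arc T g) j \<longrightarrow> (\<exists>v\<in>flow_map H (hval (schedule_arc T g) t j).
        ((\<lambda>s. hval (schedule_arc T g) s j) has_vector_derivative v) (at t within htimes (schedule_arc T g) j))"
      using flow by simp
    fix t assume "t \<in> htimes (schedule_arc T g) j" "\<exists>s\<in>htimes (schedule_arc T g) j. t < s"
    then show "hval (schedule_arc T g) t j \<in> flow_set H"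
      using trajectoryD(4)[OF g] tinterval_less[of t T j] by auto
  next
    fix t j assume "(t, j) \<in> hdom (schedule_arc T g) \<and> (t, Suc j) \<in> hdom (schedule_arc T g)"
    then have "T (Suc j) = ereal t"
      by (auto simp: schedule_domain_def tinterval_def intro: antisym)
    then show "hval (schedule_arc T g) t j \<in> jump_set H"
      and "hval (schedule_arc T g) t (Suc j) \<in> jump_map H (hval (schedule_arc T g) t j)"
      using trajectoryD(5,6)[OF g] by simp_all
  qed
qed

section \<open>Sequential compactness of solutions\<close>

text \<open>Cantor's diagonal argument: from index \<open>Suc (to_nat k)\<close> on, the diagonal
  sequence is a subsequence of the one extracted for \<open>k\<close>, and a finite initial segment
  does not affect convergence.\<close>

lemma convergent_subsequence_countable_family:
  fixes X :: "'k::countable \<Rightarrow> nat \<Rightarrow> 'b::topological_space"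
  assumes compact: "\<And>k. seq_compact (A k)" and X: "\<And>k n. X k n \<in> A k"
  obtains r where "strict_mono r" "\<And>k. \<exists>l. (\<lambda>n. X k (r n)) \<longlonglongrightarrow> l"
proof -
  interpret subseqs "\<lambda>i s. \<exists>l. (\<lambda>n. X (from_nat i) (s n)) \<longlonglongrightarrow> l"
  proof
    fix i and s :: "nat \<Rightarrow> nat" assume "strict_mono s"
    have "\<forall>n. X (from_nat i) (s n) \<in> A (from_nat i)"
      using X by blast
    then obtain l r where "l \<in> A (from_nat i)" "strict_mono r" "((\<lambda>n. X (from_nat i) (s n)) \<circ> r) \<longlonglongrightarrow> l"
      by (rule seq_compactE[OF compact])
    then show "\<exists>r'. strict_mono r' \<and> (\<exists>l. (\<lambda>n. X (from_nat i) ((s \<circ> r') n)) \<longlonglongrightarrow> l)"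
      by (auto simp: o_def)
  qed
  have "\<exists>l. (\<lambda>n. X k (diagseq n)) \<longlonglongrightarrow> l" for k
  proof -
    have "\<exists>l. (\<lambda>n. X (from_nat (to_nat k)) ((diagseq \<circ> (+) (Suc (to_nat k))) n)) \<longlonglongrightarrow> l"
    proof (rule diagseq_holds)
      fix r s :: "nat \<Rightarrow> nat" and i
      assume r: "strict_mono r" and "\<exists>l. (\<lambda>n. X (from_nat i) (s n)) \<longlonglongrightarrow> l"
      then obtain l where "(\<lambda>n. X (from_nat i) (s n)) \<longlonglongrightarrow> l"
        by blast
      from LIMSEQ_subseq_LIMSEQ[OF this r] show "\<exists>l. (\<lambda>n. X (from_nat i) ((s \<circ> r) n)) \<longlonglongrightarrow> l"
        by (auto simp: o_def)
    qed
    then obtain l where "(\<lambda>n. X k (diagseq (n + Suc (to_nat k)))) \<longlonglongrightarrow> l"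
      by (auto simp: o_def add.commute)
    from LIMSEQ_offset[of "\<lambda>n. X k (diagseq n)", OF this] show ?thesis
      by blast
  qed
  then show thesis
    using that subseq_diagseq by blast
qed

text \<open>The equicontinuity part of the Arzela-Ascoli argument: near \<open>t\<close> there is a
  rational at which all \<open>F n\<close> differ from their value at \<open>t\<close> by at most
  \<open>e / 3\<close>. The denominator \<open>M + 1\<close> covers the case
  \<open>M = 0\<close>.\<close>

lemma lipschitz_convergent_from_rationals:
  fixes F :: "nat \<Rightarrow> real \<Rightarrow> 'a::banach"
  assumes lip: "\<And>n s t. norm (F n t - F n s) \<le> M * \<bar>t - s\<bar>" and M: "0 \<le> M"
    and conv: "\<And>q::rat. convergent (\<lambda>n. F n (of_rat q))"
  shows "convergent (\<lambda>n. F n t)"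
proof (rule Cauchy_convergent, rule metric_CauchyI)
  fix e :: real assume e: "0 < e"
  have "t < t + e / 3 / (M + 1)"
    using e M by simp
  then obtain q where q: "t < of_rat q" "of_rat q < t + e / 3 / (M + 1)"
    using of_rat_dense by blast
  have "M * \<bar>of_rat q - t\<bar> \<le> (M + 1) * (e / 3 / (M + 1))"
    using q M by (intro mult_mono) auto
  also have "\<dots> = e / 3"
  proof -
    have cancel: "c * (e / 3 / c) = e / 3" if "0 < c" for c :: real
      using that by simp
    show ?thesis
      by (rule cancel) (use M in linarith)
  qed
  finally have small: "norm (F n (of_rat q) - F n t) \<le> e / 3" for n
    using lip[of n "of_rat q" t] by simp
  have "Cauchy (\<lambda>n. F n (of_rat q))"
    using conv by (rule convergent_Cauchy)
  then obtain N where N: "\<And>m n. N \<le> m \<Longrightarrow> N \<le> n \<Longrightarrow> dist (F m (of_rat q)) (F n (of_rat q)) < e / 3"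
    using e by (metis metric_CauchyD divide_pos_pos zero_less_numeral)
  have "dist (F m t) (F n t) < e" if "N \<le> m" "N \<le> n" for m n
  proof -
    have "dist (F m t) (F n t) \<le> dist (F m t) (F m (of_rat q)) + dist (F m (of_rat q)) (F n (of_rat q)) + dist (F n (of_rat q)) (F n t)"
      using dist_triangle[of "F m t" "F n t" "F m (of_rat q)"]
        dist_triangle[of "F m (of_rat q)" "F n t" "F n (of_rat q)"] by linarith
    also have "\<dots> < e / 3 + e / 3 + e / 3"
      using small[of m] small[of n] N[OF that] by (simp add: dist_norm norm_minus_commute)
    finally show ?thesis
      by simp
  qed
  then show "\<exists>N. \<forall>m\<ge>N. \<forall>n\<ge>N. dist (F m t) (F n t) < e"
    by blast
qed

lemma ereal_clip:
  assumes "0 \<le> a" "a \<le> b" "a \<noteq> \<infinity>"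
  shows "ereal (clip a b t) = max a (min (ereal t) b)"
proof -
  have "\<bar>max a (min (ereal t) b)\<bar> \<noteq> \<infinity>"
    using assms by (cases a; cases b) (auto simp: max_def min_def)
  then show ?thesis
    unfolding clip_def by (rule ereal_real')
qed

text \<open>A working form of graphical convergence of hybrid arcs. Jump times converge in the
  extended reals, so a jump may disappear to infinity, and values are compared through their
  extensions to the whole line.\<close>

definition schedule_converges :: "(nat \<Rightarrow> nat \<Rightarrow> ereal) \<Rightarrow> (nat \<Rightarrow> nat \<Rightarrow> real \<Rightarrow> 'a::real_normed_vector) \<Rightarrow>
    (nat \<Rightarrow> ereal) \<Rightarrow> (nat \<Rightarrow> real \<Rightarrow> 'a) \<Rightarrow> bool" where
  "schedule_converges S f T g \<longleftrightarrow> (\<forall>j. (\<lambda>n. S n j) \<longlonglongrightarrow> T j) \<and>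
     (\<forall>j t. (\<lambda>n. clipped (S n) (f n) j t) \<longlonglongrightarrow> g j t)"

lemma schedule_converges_subseq:
  assumes "schedule_converges S f T g" "strict_mono r"
  shows "schedule_converges (\<lambda>n. S (r n)) (\<lambda>n. f (r n)) T g"
  unfolding schedule_converges_def
proof (intro conjI allI)
  show "(\<lambda>n. S (r n) j) \<longlonglongrightarrow> T j" for j
    using LIMSEQ_subseq_LIMSEQ[of "\<lambda>n. S n j" "T j", OF _ assms(2)] assms(1)
    by (simp add: schedule_converges_def o_def)
  show "(\<lambda>n. clipped (S (r n)) (f (r n)) j t) \<longlonglongrightarrow> g j t" for j t
    using LIMSEQ_subseq_LIMSEQ[of "\<lambda>n. clipped (S n) (f n) j t" "g j t", OF _ assms(2)] assms(1)
    by (simp add: schedule_converges_def o_def)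
qed

section \<open>Limits of trajectories are trajectories\<close>

locale converging_trajectories =
  fixes H :: "'a::euclidean_space hybrid_system" and M R :: real
    and S :: "nat \<Rightarrow> nat \<Rightarrow> ereal" and f :: "nat \<Rightarrow> nat \<Rightarrow> real \<Rightarrow> 'a"
    and T :: "nat \<Rightarrow> ereal" and g :: "nat \<Rightarrow> real \<Rightarrow> 'a"
  assumes H: "basic_assumptions H" and M: "0 \<le> M"
    and traj: "\<And>n. trajectory H M R (S n) (f n)"
    and conv: "schedule_converges S f T g"
begin

lemma S_lim: "(\<lambda>n. S n j) \<longlonglongrightarrow> T j"
  using conv by (simp add: schedule_converges_def)

text \<open>The evaluation times must be allowed to vary with \<open>n\<close>, because
  \<open>t\<close> may lie outside the domains of the approximating trajectories; the common
  Lipschitz constant absorbs the difference.\<close>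

lemma value_lim:
  assumes a: "a \<longlonglongrightarrow> t" and dom: "\<forall>\<^sub>F n in sequentially. a n \<in> tinterval (S n) j"
  shows "(\<lambda>n. f n j (a n)) \<longlonglongrightarrow> g j t"
proof -
  have "(\<lambda>n. clipped (S n) (f n) j (a n) - clipped (S n) (f n) j t) \<longlonglongrightarrow> 0"
  proof (rule Lim_null_comparison)
    show "\<forall>\<^sub>F n in sequentially. norm (clipped (S n) (f n) j (a n) - clipped (S n) (f n) j t) \<le> M * \<bar>a n - t\<bar>"
      using clipped_lipschitz[OF traj M] by (intro always_eventually allI)
    have "(\<lambda>n. \<bar>a n - t\<bar>) \<longlonglongrightarrow> 0"
      using a by (simp add: LIM_zero_iff tendsto_rabs_zero_iff)
    then show "(\<lambda>n. M * \<bar>a n - t\<bar>) \<longlonglongrightarrow> 0"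
      by (rule tendsto_mult_right_zero)
  qed
  moreover have "(\<lambda>n. clipped (S n) (f n) j t) \<longlonglongrightarrow> g j t"
    using conv by (simp add: schedule_converges_def)
  ultimately have "(\<lambda>n. clipped (S n) (f n) j (a n)) \<longlonglongrightarrow> g j t"
    using tendsto_add by fastforce
  then show ?thesis
    by (rule Lim_transform_eventually)
      (use dom in eventually_elim, use clipped_eq trajectoryD(1)[OF traj] in blast)
qed

lemma tinterval_lim:
  assumes a: "a \<longlonglongrightarrow> t" and dom: "\<forall>\<^sub>F n in sequentially. a n \<in> tinterval (S n) j"
  shows "t \<in> tinterval T j"
proof -
  have ea: "(\<lambda>n. ereal (a n)) \<longlonglongrightarrow> ereal t"
    using a by simp
  have "T j \<le> ereal t"
    using dom by (intro tendsto_le[OF _ ea S_lim]) (auto elim: eventually_mono simp: tinterval_def)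
  moreover have "ereal t \<le> T (Suc j)"
    using dom by (intro tendsto_le[OF _ S_lim ea]) (auto elim: eventually_mono simp: tinterval_def)
  ultimately show ?thesis
    by (simp add: tinterval_def)
qed

lemma S_finite: "T j \<noteq> \<infinity> \<Longrightarrow> \<forall>\<^sub>F n in sequentially. S n j \<noteq> \<infinity>"
  using order_tendstoD(2)[OF S_lim, of j \<infinity>] by (simp add: less_top)

text \<open>The witness is the projection of \<open>t\<close> to the \<open>n\<close>-th interval,
  whose ends converge. The left end \<open>T j\<close> is finite, so the left ends
  \<open>S n j\<close> are eventually finite and the projection is meaningful.\<close>

lemma approximants:
  assumes "t \<in> tinterval T j"
  obtains a where "a \<longlonglongrightarrow> t" "\<forall>\<^sub>F n in sequentially. a n \<in> tinterval (S n) j"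
proof
  let ?a = "\<lambda>n. clip (S n j) (S n (Suc j)) t"
  have "T j \<noteq> \<infinity>"
    using assms by (auto simp: tinterval_def)
  then have fin: "\<forall>\<^sub>F n in sequentially. S n j \<noteq> \<infinity>"
    by (rule S_finite)
  have "(\<lambda>n. max (S n j) (min (ereal t) (S n (Suc j)))) \<longlonglongrightarrow> max (T j) (min (ereal t) (T (Suc j)))"
    by (intro tendsto_max tendsto_min tendsto_const S_lim)
  also have "max (T j) (min (ereal t) (T (Suc j))) = ereal t"
    using assms by (simp add: tinterval_def max_def min_def)
  finally have "(\<lambda>n. ereal (?a n)) \<longlonglongrightarrow> ereal t"
  proof (rule Lim_transform_eventually)
    show "\<forall>\<^sub>F n in sequentially. max (S n j) (min (ereal t) (S n (Suc j))) = ereal (?a n)"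
      using fin
    proof eventually_elim
      case (elim n)
      then show ?case
        using ereal_clip schedule_nonneg schedule_mono[of "S n" j "Suc j"] trajectoryD(1)[OF traj] by simp
    qed
  qed
  then show "?a \<longlonglongrightarrow> t"
    by simp
  show "\<forall>\<^sub>F n in sequentially. ?a n \<in> tinterval (S n) j"
    using fin by eventually_elim (rule clip_tinterval[OF trajectoryD(1)[OF traj]])
qed

lemma schedule_lim: "schedule T"
  unfolding schedule_def
proof
  have "S n 0 = 0" for n
    using trajectoryD(1)[OF traj] by (simp add: schedule_def)
  then show "T 0 = 0"
    using LIMSEQ_unique[OF S_lim[of 0]] by simp
  show "incseq T"
  proof (rule incseq_SucI)
    show "T j \<le> T (Suc j)" for j
      using schedule_mono[OF trajectoryD(1)[OF traj], of j "Suc j"] by (intro LIMSEQ_le[OF S_lim S_lim]) auto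
  qed
qed

lemma S_less:
  assumes "T j < T (Suc j)"
  shows "\<forall>\<^sub>F n in sequentially. S n j < S n (Suc j)"
proof -
  obtain c where c: "T j < c" "c < T (Suc j)"
    using assms dense by blast
  have "\<forall>\<^sub>F n in sequentially. S n j < c" "\<forall>\<^sub>F n in sequentially. c < S n (Suc j)"
    using order_tendstoD[OF S_lim] c by auto
  then show ?thesis
    by eventually_elim (rule less_trans)
qed

lemma in_flow_set:
  assumes t: "t \<in> tinterval T j" and less: "T j < T (Suc j)"
  shows "g j t \<in> flow_set H"
proof -
  obtain a where a: "a \<longlonglongrightarrow> t" "\<forall>\<^sub>F n in sequentially. a n \<in> tinterval (S n) j"
    using approximants[OF t] .
  have "\<forall>\<^sub>F n in sequentially. f n j (a n) \<in> flow_set H"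
    using a(2) S_less[OF less] by eventually_elim (rule trajectoryD(4)[OF traj])
  then show ?thesis
    by (rule Lim_in_closed_set[OF basic_assumptionsD(1)[OF H] _ _ value_lim[OF a]]) simp
qed

lemma in_jump_map:
  assumes t: "T (Suc j) = ereal t"
  shows "g j t \<in> jump_set H" "g (Suc j) t \<in> jump_map H (g j t)"
proof -
  \<comment> \<open>The jump times of the approximating trajectories themselves serve as evaluation
    times, since they belong to the intervals before and after the jump.\<close>
  let ?a = "\<lambda>n. real_of_ereal (S n (Suc j))"
  have fin: "\<forall>\<^sub>F n in sequentially. S n (Suc j) \<noteq> \<infinity>"
    using S_finite t by simp
  have a_eq: "\<forall>\<^sub>F n in sequentially. S n (Suc j) = ereal (?a n)"
    using fin
  proof eventually_elim
    case (elim n)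
    then show ?case
      using schedule_nonneg[OF trajectoryD(1)[OF traj], of n "Suc j"] by (cases "S n (Suc j)") auto
  qed
  have "(\<lambda>n. ereal (?a n)) \<longlonglongrightarrow> ereal t"
    using Lim_transform_eventually[OF S_lim a_eq] t by simp
  then have a: "?a \<longlonglongrightarrow> t"
    by simp
  have dom: "\<forall>\<^sub>F n in sequentially. ?a n \<in> tinterval (S n) j" "\<forall>\<^sub>F n in sequentially. ?a n \<in> tinterval (S n) (Suc j)"
  proof -
    have "S n j \<le> S n (Suc j)" "S n (Suc j) \<le> S n (Suc (Suc j))" for n
      using schedule_mono[OF trajectoryD(1)[OF traj]] by auto
    with a_eq show "\<forall>\<^sub>F n in sequentially. ?a n \<in> tinterval (S n) j" "\<forall>\<^sub>F n in sequentially. ?a n \<in> tinterval (S n) (Suc j)"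
      by (auto elim!: eventually_mono simp: tinterval_def)
  qed
  have "\<forall>\<^sub>F n in sequentially. f n j (?a n) \<in> jump_set H"
    using a_eq by eventually_elim (rule trajectoryD(5)[OF traj])
  then show "g j t \<in> jump_set H"
    by (rule Lim_in_closed_set[OF basic_assumptionsD(2)[OF H] _ _ value_lim[OF a dom(1)]]) simp
  have "\<forall>\<^sub>F n in sequentially. f n (Suc j) (?a n) \<in> jump_map H (f n j (?a n))"
    using a_eq by eventually_elim (rule trajectoryD(6)[OF traj])
  then obtain N where N: "\<And>n. N \<le> n \<Longrightarrow> f n (Suc j) (?a n) \<in> jump_map H (f n j (?a n))"
    unfolding eventually_sequentially by blast
  show "g (Suc j) t \<in> jump_map H (g j t)"
  proof (rule outer_semicontinuousD[OF basic_assumptionsD(4)[OF H]])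
    show "f (n + N) (Suc j) (?a (n + N)) \<in> jump_map H (f (n + N) j (?a (n + N)))" for n
      using N by simp
    show "(\<lambda>n. f (n + N) j (?a (n + N))) \<longlonglongrightarrow> g j t" "(\<lambda>n. f (n + N) (Suc j) (?a (n + N))) \<longlonglongrightarrow> g (Suc j) t"
      using LIMSEQ_ignore_initial_segment[OF value_lim[OF a dom(1)], of N]
        LIMSEQ_ignore_initial_segment[OF value_lim[OF a dom(2)], of N] by auto
  qed
qed

text \<open>Otherwise violating times accumulate at some \<open>u0\<close> in \<open>{s..t}\<close>,
  the states there converge to \<open>g j u0\<close>, and the violating velocities yield a
  \<open>w0\<close> in the flow map at \<open>g j u0\<close> with
  \<open>c' \<le> p \<bullet> w0\<close>. The gap between \<open>c\<close> and \<open>c'\<close> is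
  what survives the limit.\<close>

lemma support_bound_eventually:
  assumes a: "a \<longlonglongrightarrow> s" "\<forall>\<^sub>F n in sequentially. a n \<in> tinterval (S n) j"
    and b: "b \<longlonglongrightarrow> t" "\<forall>\<^sub>F n in sequentially. b n \<in> tinterval (S n) j"
    and st: "s < t" and le: "\<And>u w. u \<in> {s..t} \<Longrightarrow> w \<in> flow_map H (g j u) \<Longrightarrow> p \<bullet> w \<le> c" and c: "c < c'"
  shows "\<forall>\<^sub>F n in sequentially. \<forall>u\<in>{a n..b n}. \<forall>w\<in>flow_map H (f n j u). p \<bullet> w \<le> c'"
proof (rule ccontr)
  let ?P = "\<lambda>n. \<forall>u\<in>{a n..b n}. \<forall>w\<in>flow_map H (f n j u). p \<bullet> w \<le> c'"
  \<comment> \<open>The property \<open>?P\<close> fails only for infinitely many \<open>n\<close>;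
    attaching the eventual facts \<open>?Q\<close> before extracting a subsequence ensures that the
    violating indices also have admissible, ordered times.\<close>
  let ?Q = "\<lambda>n. a n \<in> tinterval (S n) j \<and> b n \<in> tinterval (S n) j \<and> a n < b n"
  have "\<forall>\<^sub>F n in sequentially. 0 < b n - a n"
    using order_tendstoD(1)[OF tendsto_diff[OF b(1) a(1)], of 0] st by simp
  with a(2) b(2) have Q: "\<forall>\<^sub>F n in sequentially. ?Q n"
    by eventually_elim auto
  assume not_P: "\<not> eventually ?P sequentially"
  have "\<not> (\<forall>\<^sub>F n in sequentially. ?Q n \<longrightarrow> ?P n)"
  proof
    assume "\<forall>\<^sub>F n in sequentially. ?Q n \<longrightarrow> ?P n"
    with Q have "eventually ?P sequentially"
      by (rule eventually_rev_mp)
    with not_P show False ..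
  qed
  from not_eventually_sequentiallyD[OF this] obtain r :: "nat \<Rightarrow> nat"
    where r: "strict_mono r" "\<And>n. \<not> (?Q (r n) \<longrightarrow> ?P (r n))"
    by auto
  have "\<forall>n. \<exists>u w. u \<in> {a (r n)..b (r n)} \<and> w \<in> flow_map H (f (r n) j u) \<and> c' < p \<bullet> w"
    using r(2) by (meson not_le)
  then obtain u w where u: "\<And>n. u n \<in> {a (r n)..b (r n)}" and w: "\<And>n. w n \<in> flow_map H (f (r n) j (u n))" "\<And>n. c' < p \<bullet> w n"
    by metis
  obtain A where A: "\<And>n. \<bar>a n\<bar> \<le> A"
    using convergent_imp_bounded[of a] a(1) unfolding bounded_iff by auto
  obtain B where B: "\<And>n. \<bar>b n\<bar> \<le> B"
    using convergent_imp_bounded[of b] b(1) unfolding bounded_iff by auto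
  have "\<bar>u n\<bar> \<le> A + B" for n
    using u[of n] A[of "r n"] B[of "r n"] by auto
  then have "bounded (range u)"
    unfolding bounded_iff by auto
  then obtain u0 r' where r': "strict_mono r'" "(u \<circ> r') \<longlonglongrightarrow> u0"
    using bounded_imp_convergent_subsequence by blast
  let ?r = "\<lambda>n. r (r' n)"
  have rr: "strict_mono ?r"
    using r(1) r'(1) by (simp add: strict_mono_def)
  have "u0 \<in> {s..t}"
    using LIMSEQ_le[OF LIMSEQ_subseq_LIMSEQ[OF a(1) rr] r'(2)] LIMSEQ_le[OF r'(2) LIMSEQ_subseq_LIMSEQ[OF b(1) rr]] u
    by (auto simp: o_def)
  interpret sub: converging_trajectories H M R "\<lambda>n. S (?r n)" "\<lambda>n. f (?r n)" T g
    by (rule converging_trajectories.intro) (rule H M traj schedule_converges_subseq[OF conv rr])+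
  have uI: "u n \<in> tinterval (S (r n)) j" for n
    using r(2)[of n] u[of n] tinterval_convex by blast
  have lim: "(\<lambda>n. f (?r n) j (u (r' n))) \<longlonglongrightarrow> g j u0"
    using r'(2) uI by (intro sub.value_lim) (auto simp: o_def)
  have "f (?r n) j (u (r' n)) \<in> flow_set H" for n
    using r(2)[of "r' n"] tinterval_less uI by (intro trajectoryD(4)[OF traj]) blast+
  then obtain w0 where "w0 \<in> flow_map H (g j u0)" "c' \<le> p \<bullet> w0"
    by (rule flow_map_support_limit[OF H _ lim, of "\<lambda>n. w (r' n)" c' p]) (use w in \<open>auto intro: less_imp_le\<close>)
  then show False
    using le \<open>u0 \<in> {s..t}\<close> c by fastforce
qed

lemma trajectory_lim: "trajectory H M R T g"
  unfolding trajectory_def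
proof (intro conjI allI ballI impI)
  show "schedule T"
    by (rule schedule_lim)
  fix j s t assume s: "s \<in> tinterval T j" and t: "t \<in> tinterval T j"
  obtain a where a: "a \<longlonglongrightarrow> s" "\<forall>\<^sub>F n in sequentially. a n \<in> tinterval (S n) j"
    using approximants[OF s] .
  obtain b where b: "b \<longlonglongrightarrow> t" "\<forall>\<^sub>F n in sequentially. b n \<in> tinterval (S n) j"
    using approximants[OF t] .
  show "norm (g j t - g j s) \<le> M * \<bar>t - s\<bar>"
  proof (rule tendsto_le)
    show "(\<lambda>n. M * \<bar>b n - a n\<bar>) \<longlonglongrightarrow> M * \<bar>t - s\<bar>"
      using a b by (intro tendsto_intros)
    show "(\<lambda>n. norm (f n j (b n) - f n j (a n))) \<longlonglongrightarrow> norm (g j t - g j s)"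
      by (intro tendsto_intros value_lim[OF a] value_lim[OF b])
    show "\<forall>\<^sub>F n in sequentially. norm (f n j (b n) - f n j (a n)) \<le> M * \<bar>b n - a n\<bar>"
      using a(2) b(2) by eventually_elim (rule trajectoryD(3)[OF traj])
  qed simp
  fix p c assume st: "s < t" and le: "\<forall>u\<in>{s..t}. \<forall>w\<in>flow_map H (g j u). p \<bullet> w \<le> c"
  \<comment> \<open>The approximating trajectories satisfy the velocity bound only with slack, so
    the inequality is shown for every \<open>c'\<close> above \<open>c\<close> and density gives it
    for \<open>c\<close>.\<close>
  have "p \<bullet> (g j t - g j s) \<le> c' * (t - s)" if c': "c < c'" for c'
  proof (rule tendsto_le)
    show "(\<lambda>n. c' * (b n - a n)) \<longlonglongrightarrow> c' * (t - s)"
      using a b by (intro tendsto_intros)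
    show "(\<lambda>n. p \<bullet> (f n j (b n) - f n j (a n))) \<longlonglongrightarrow> p \<bullet> (g j t - g j s)"
      by (intro tendsto_intros value_lim[OF a] value_lim[OF b])
    have "\<forall>\<^sub>F n in sequentially. 0 < b n - a n"
      using order_tendstoD(1)[OF tendsto_diff[OF b(1) a(1)], of 0] st by simp
    moreover have "\<forall>\<^sub>F n in sequentially. \<forall>u\<in>{a n..b n}. \<forall>w\<in>flow_map H (f n j u). p \<bullet> w \<le> c'"
      using support_bound_eventually[OF a b st _ c'] le by blast
    ultimately show "\<forall>\<^sub>F n in sequentially. p \<bullet> (f n j (b n) - f n j (a n)) \<le> c' * (b n - a n)"
      using a(2) b(2)
    proof eventually_elim
      case (elim n)
      then show ?case
        by (intro trajectoryD(7)[OF traj]) auto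
    qed
  qed simp
  then have "p \<bullet> (g j t - g j s) / (t - s) \<le> c'" if "c < c'" for c'
    using that st by (simp add: divide_le_eq)
  then have "p \<bullet> (g j t - g j s) / (t - s) \<le> c"
    by (rule dense_ge)
  then show "p \<bullet> (g j t - g j s) \<le> c * (t - s)"
    using st by (simp add: divide_le_eq)
next
  fix j t assume t: "t \<in> tinterval T j"
  obtain a where a: "a \<longlonglongrightarrow> t" "\<forall>\<^sub>F n in sequentially. a n \<in> tinterval (S n) j"
    using approximants[OF t] .
  have "\<forall>\<^sub>F n in sequentially. norm (f n j (a n)) \<le> R"
    using a(2) by eventually_elim (rule trajectoryD(2)[OF traj])
  then show "norm (g j t) \<le> R"
    by (rule Lim_norm_ubound[OF _ value_lim[OF a], rotated]) simp
qed (use in_flow_set in_jump_map in auto)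

end

text \<open>Two extractions: the jump times live in the compact extended reals, and the extended
  values at rational times live in a closed ball. The Lipschitz constant then gives convergence at
  all times.\<close>

lemma trajectory_compactness:
  fixes H :: "'a::euclidean_space hybrid_system" and S :: "nat \<Rightarrow> nat \<Rightarrow> ereal"
  assumes H: "basic_assumptions H" and M: "0 \<le> M" and traj: "\<And>n. trajectory H M R (S n) (f n)"
  obtains r T g where "strict_mono r" "converging_trajectories H M R (\<lambda>n. S (r n)) (\<lambda>n. f (r n)) T g"
proof -
  obtain r1 where r1: "strict_mono r1" "\<And>j. \<exists>l. (\<lambda>n. S (r1 n) j) \<longlonglongrightarrow> l"
    using convergent_subsequence_countable_family[of "\<lambda>_. UNIV" "\<lambda>j n. S n j"]
      compact_imp_seq_compact[OF compact_UNIV] by auto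
  \<comment> \<open>The radius is \<open>\<bar>R\<bar>\<close> so that the ball certainly contains
    the default value 0 of indices that are never reached.\<close>
  have in_cball: "clipped (S n) (f n) j t \<in> cball 0 \<bar>R\<bar>" for n j t
  proof (cases "S n j = \<infinity>")
    case False
    then show ?thesis
      using trajectoryD(2)[OF traj clip_tinterval[OF trajectoryD(1)[OF traj] False], of t] by (simp add: clipped_def)
  qed (simp add: clipped_def)
  obtain r2 where r2: "strict_mono r2" "\<And>jq::nat \<times> rat. \<exists>l. (\<lambda>n. clipped (S (r1 (r2 n))) (f (r1 (r2 n))) (fst jq) (of_rat (snd jq))) \<longlonglongrightarrow> l"
    by (rule convergent_subsequence_countable_family[of "\<lambda>_. cball 0 \<bar>R\<bar>" "\<lambda>jq n. clipped (S (r1 n)) (f (r1 n)) (fst jq) (of_rat (snd jq))"])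
      (use in_cball compact_imp_seq_compact[OF compact_cball] in auto)
  define r where "r n = r1 (r2 n)" for n
  have "convergent (\<lambda>n. clipped (S (r n)) (f (r n)) j t)" for j t
  proof (rule lipschitz_convergent_from_rationals[OF clipped_lipschitz[OF traj M] M])
    show "convergent (\<lambda>n. clipped (S (r n)) (f (r n)) j (of_rat q))" for q
      using r2(2)[of "(j, q)"] by (auto simp: convergent_def r_def)
  qed
  then obtain g where g: "\<And>j t. (\<lambda>n. clipped (S (r n)) (f (r n)) j t) \<longlonglongrightarrow> g j t"
    unfolding convergent_def by metis
  obtain T where T: "\<And>j. (\<lambda>n. S (r1 n) j) \<longlonglongrightarrow> T j"
    using r1(2) by metis
  have "strict_mono r"
    using r1(1) r2(1) by (simp add: r_def strict_mono_def)
  moreover have "converging_trajectories H M R (\<lambda>n. S (r n)) (\<lambda>n. f (r n)) T g"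
  proof
    show "schedule_converges (\<lambda>n. S (r n)) (\<lambda>n. f (r n)) T g"
      using g LIMSEQ_subseq_LIMSEQ[OF T r2(1)] by (auto simp: schedule_converges_def r_def o_def)
  qed (use H M traj in auto)
  ultimately show thesis
    using that by blast
qed

section \<open>The omega-limit set\<close>

text \<open>Entry 0 is set to 0 and not to \<open>T k - ereal s\<close>, because the shifted arc
  begins inside the \<open>k\<close>-th interval and forgets its earlier part.\<close>

definition shift_schedule :: "(nat \<Rightarrow> ereal) \<Rightarrow> real \<Rightarrow> nat \<Rightarrow> nat \<Rightarrow> ereal" where
  "shift_schedule T s k j = (if j = 0 then 0 else T (k + j) - ereal s)"

definition shift_values :: "(nat \<Rightarrow> real \<Rightarrow> 'a) \<Rightarrow> real \<Rightarrow> nat \<Rightarrow> nat \<Rightarrow> real \<Rightarrow> 'a" where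
  "shift_values g s k j t = g (k + j) (s + t)"

lemma tinterval_shift:
  assumes T: "schedule T" and s: "s \<in> tinterval T k"
  shows "t \<in> tinterval (shift_schedule T s k) j \<longleftrightarrow> 0 \<le> t \<and> s + t \<in> tinterval T (k + j)"
proof (cases j)
  case 0
  have "T k \<le> ereal (s + t)" if "0 \<le> t"
    using s that by (auto simp: tinterval_def intro: order_trans)
  then show ?thesis
    using 0 by (auto simp: tinterval_def shift_schedule_def ereal_le_minus add.commute zero_ereal_def)
next
  case (Suc i)
  have "ereal s \<le> T (k + j)"
    using s schedule_mono[OF T, of "Suc k" "k + j"] Suc by (auto simp: tinterval_def intro: order_trans)
  then have "0 \<le> t" if "T (k + j) \<le> ereal (s + t)"
    using order_trans[OF _ that, of "ereal s"] by simp
  then show ?thesis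
    using Suc by (auto simp: tinterval_def shift_schedule_def ereal_le_minus ereal_minus_le add.commute)
qed

lemma trajectory_shift:
  assumes g: "trajectory H M R T g" and s: "s \<in> tinterval T k"
  shows "trajectory H M R (shift_schedule T s k) (shift_values g s k)"
proof -
  note T = trajectoryD(1)[OF g]
  note shift = tinterval_shift[OF T s]
  have after: "ereal s \<le> T (k + Suc j)" for j
    using s schedule_mono[OF T, of "Suc k" "k + Suc j"] by (auto simp: tinterval_def intro: order_trans)
  have sched: "schedule (shift_schedule T s k)"
    unfolding schedule_def
  proof
    show "incseq (shift_schedule T s k)"
    proof (rule incseq_SucI)
      fix j show "shift_schedule T s k j \<le> shift_schedule T s k (Suc j)"
      proof (cases j)
        case 0
        then show ?thesis
          using after[of 0] by (simp add: shift_schedule_def ereal_le_minus)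
      next
        case (Suc i)
        then show ?thesis
          using schedule_mono[OF T, of "k + Suc i" "k + Suc (Suc i)"]
          by (auto simp: shift_schedule_def intro!: ereal_minus_mono)
      qed
    qed
  qed (simp add: shift_schedule_def)
  \<comment> \<open>The flow-set condition concerns nondegenerate intervals only. A nondegenerate
    shifted interval comes from a nondegenerate original one; for index 0 this uses that
    \<open>s\<close> itself lies in the \<open>k\<close>-th interval.\<close>
  have less: "T (k + j) < T (Suc (k + j))" if "shift_schedule T s k j < shift_schedule T s k (Suc j)" for j
  proof (rule ccontr)
    assume "\<not> ?thesis"
    then have eq: "T (k + j) = T (Suc (k + j))"
      using schedule_mono[OF T, of "k + j" "Suc (k + j)"] by simp
    show False
    proof (cases j)
      case 0
      then have "T (Suc k) = ereal s"
        using eq s by (auto simp: tinterval_def)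
      then show False
        using that 0 by (simp add: shift_schedule_def)
    next
      case (Suc i)
      then show False
        using that eq by (simp add: shift_schedule_def)
    qed
  qed
  show ?thesis
    unfolding trajectory_def
  proof (intro conjI allI ballI impI sched)
    fix j t assume t: "t \<in> tinterval (shift_schedule T s k) j"
    show "norm (shift_values g s k j t) \<le> R"
      using t trajectoryD(2)[OF g] by (simp add: shift shift_values_def)
    show "shift_values g s k j t \<in> flow_set H" if "shift_schedule T s k j < shift_schedule T s k (Suc j)"
      using t trajectoryD(4)[OF g] less[OF that] by (simp add: shift shift_values_def)
  next
    fix j a b assume ab: "a \<in> tinterval (shift_schedule T s k) j" "b \<in> tinterval (shift_schedule T s k) j"
    show "norm (shift_values g s k j b - shift_values g s k j a) \<le> M * \<bar>b - a\<bar>"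
      using trajectoryD(3)[OF g, of "s + a" "k + j" "s + b"] ab by (simp add: shift shift_values_def)
    fix p c assume "a < b" and le: "\<forall>u\<in>{a..b}. \<forall>w\<in>flow_map H (shift_values g s k j u). p \<bullet> w \<le> c"
    have "p \<bullet> (g (k + j) (s + b) - g (k + j) (s + a)) \<le> c * ((s + b) - (s + a))"
    proof (rule trajectoryD(7)[OF g])
      fix u w assume u: "u \<in> {s + a..s + b}" "w \<in> flow_map H (g (k + j) u)"
      then have "u - s \<in> {a..b}" "w \<in> flow_map H (shift_values g s k j (u - s))"
        by (auto simp: shift_values_def)
      then show "p \<bullet> w \<le> c"
        using le by blast
    qed (use ab \<open>a < b\<close> in \<open>auto simp: shift\<close>)
    then show "p \<bullet> (shift_values g s k j b - shift_values g s k j a) \<le> c * (b - a)"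
      by (simp add: shift_values_def)
  next
    fix j t assume "shift_schedule T s k (Suc j) = ereal t"
    then have "T (Suc (k + j)) = ereal (s + t)"
      by (cases "T (Suc (k + j))") (auto simp: shift_schedule_def)
    then show "shift_values g s k j t \<in> jump_set H"
      and "shift_values g s k (Suc j) t \<in> jump_map H (shift_values g s k j t)"
      using trajectoryD(5,6)[OF g] by (simp_all add: shift_values_def)
  qed
qed

definition omega_limit :: "(nat \<Rightarrow> ereal) \<Rightarrow> (nat \<Rightarrow> real \<Rightarrow> 'a::topological_space) \<Rightarrow> 'a set" where
  "omega_limit T g = {q. \<exists>s k. (\<forall>n. s n \<in> tinterval T (k n)) \<and>
     filterlim (\<lambda>n. s n + real (k n)) at_top sequentially \<and> (\<lambda>n. g (k n) (s n)) \<longlonglongrightarrow> q}"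

text \<open>Within a single time domain the number \<open>t + j\<close> orders both coordinates at
  once. Thus hybrid times can be compared by one real number, and the difference of two of them is
  again a nonnegative time and a natural number.\<close>

lemma schedule_domain_order:
  assumes T: "schedule T" and st: "s \<in> tinterval T k" "t \<in> tinterval T j" "s + real k \<le> t + real j"
  shows "s \<le> t" "k \<le> j"
proof -
  show "k \<le> j"
  proof (rule ccontr)
    assume "\<not> k \<le> j"
    have "ereal t \<le> T (Suc j)"
      using st(2) by (simp add: tinterval_def)
    also have "\<dots> \<le> T k"
      using \<open>\<not> k \<le> j\<close> by (intro schedule_mono[OF T]) simp
    also have "\<dots> \<le> ereal s"
      using st(1) by (simp add: tinterval_def)
    finally show False
      using st(3) \<open>\<not> k \<le> j\<close> by simp
  qed
  show "s \<le> t"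
  proof (cases "k = j")
    case False
    have "ereal s \<le> T (Suc k)"
      using st(1) by (simp add: tinterval_def)
    also have "\<dots> \<le> T j"
      using \<open>k \<le> j\<close> False by (intro schedule_mono[OF T]) simp
    also have "\<dots> \<le> ereal t"
      using st(2) by (simp add: tinterval_def)
    finally show ?thesis
      by simp
  qed (use st(3) in simp)
qed

text \<open>A value of the limit at \<open>(t, j)\<close> is a limit of values of \<open>g\<close>
  at times \<open>s + a\<close> with index \<open>k + j\<close>, where \<open>a\<close> tends to
  \<open>t\<close>; these hybrid times go to infinity with \<open>s + k\<close>.\<close>

lemma omega_limit_trajectory:
  fixes H :: "'a::euclidean_space hybrid_system"
  assumes H: "basic_assumptions H" and M: "0 \<le> M" and g: "trajectory H M R T g"
    and s: "\<And>n. s n \<in> tinterval T (k n)" and top: "filterlim (\<lambda>n. s n + real (k n)) at_top sequentially"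
  obtains r T' g' where "strict_mono r"
    "converging_trajectories H M R (\<lambda>n. shift_schedule T (s (r n)) (k (r n))) (\<lambda>n. shift_values g (s (r n)) (k (r n))) T' g'"
    "\<forall>j. \<forall>t\<in>tinterval T' j. g' j t \<in> omega_limit T g"
proof -
  have "trajectory H M R (shift_schedule T (s n) (k n)) (shift_values g (s n) (k n))" for n
    using trajectory_shift[OF g s] .
  from trajectory_compactness[OF H M this]
  obtain r T' g' where r: "strict_mono r" and ct: "converging_trajectories H M R
      (\<lambda>n. shift_schedule T (s (r n)) (k (r n))) (\<lambda>n. shift_values g (s (r n)) (k (r n))) T' g'" .
  interpret converging_trajectories H M R "\<lambda>n. shift_schedule T (s (r n)) (k (r n))"
      "\<lambda>n. shift_values g (s (r n)) (k (r n))" T' g'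
    by (rule ct)
  have "g' j t \<in> omega_limit T g" if t: "t \<in> tinterval T' j" for j t
  proof -
    obtain a where a: "a \<longlonglongrightarrow> t" "\<forall>\<^sub>F n in sequentially. a n \<in> tinterval (shift_schedule T (s (r n)) (k (r n))) j"
      using approximants[OF t] .
    then obtain N where N: "\<And>n. N \<le> n \<Longrightarrow> a n \<in> tinterval (shift_schedule T (s (r n)) (k (r n))) j"
      unfolding eventually_sequentially by blast
    have a': "0 \<le> a n" "s (r n) + a n \<in> tinterval T (k (r n) + j)" if "N \<le> n" for n
      using N[OF that] tinterval_shift[OF trajectoryD(1)[OF g] s] by auto
    let ?s = "\<lambda>n. s (r (n + N)) + a (n + N)" and ?k = "\<lambda>n. k (r (n + N)) + j"
    have "\<forall>n. ?s n \<in> tinterval T (?k n)"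
      using a'(2) by simp
    moreover have "filterlim (\<lambda>n. ?s n + real (?k n)) at_top sequentially"
    proof (rule filterlim_at_top_mono)
      have "strict_mono (\<lambda>n. r (n + N))"
        using r by (simp add: strict_mono_def)
      then show "filterlim (\<lambda>n. s (r (n + N)) + real (k (r (n + N)))) at_top sequentially"
        by (rule filterlim_compose[OF top filterlim_subseq])
      show "\<forall>\<^sub>F n in sequentially. s (r (n + N)) + real (k (r (n + N))) \<le> ?s n + real (?k n)"
        using a'(1) by (intro always_eventually allI) (simp add: add_increasing2)
    qed
    moreover have "(\<lambda>n. g (?k n) (?s n)) \<longlonglongrightarrow> g' j t"
      using LIMSEQ_ignore_initial_segment[OF value_lim[OF a], of N] by (simp add: shift_values_def)
    ultimately show ?thesis
      unfolding omega_limit_def by (intro CollectI exI[of _ ?s] exI[of _ ?k] conjI)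
  qed
  then have "\<forall>j. \<forall>t\<in>tinterval T' j. g' j t \<in> omega_limit T g"
    by blast
  with r ct show thesis
    by (rule that)
qed

lemma zero_in_shift: "schedule T \<Longrightarrow> s \<in> tinterval T k \<Longrightarrow> 0 \<in> tinterval (shift_schedule T s k) 0"
  by (simp add: tinterval_shift)

lemma (in converging_trajectories) initial_value_lim:
  assumes "(\<lambda>n. f n 0 0) \<longlonglongrightarrow> q" and "\<And>n. 0 \<in> tinterval (S n) 0"
  shows "g 0 0 = q"
  using LIMSEQ_unique[OF value_lim[OF tendsto_const, of 0 0] assms(1)] assms(2) by simp

lemma hrange_schedule_arc: "hrange (schedule_arc T g) = {g j t |j t. t \<in> tinterval T j}"
  by (auto simp: hrange_def schedule_domain_def)

text \<open>The times along which the values approach \<open>q\<close> are used as shifts, so the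
  limit trajectory starts at \<open>q\<close>.\<close>

lemma omega_limit_weakly_forward_invariant:
  fixes H :: "'a::euclidean_space hybrid_system"
  assumes H: "basic_assumptions H" and M: "0 \<le> M" and g: "trajectory H M R T g"
  shows "weakly_forward_invariant H (omega_limit T g)"
  unfolding weakly_forward_invariant_def
proof
  fix q assume "q \<in> omega_limit T g"
  then obtain s k where s: "\<And>n. s n \<in> tinterval T (k n)"
      and top: "filterlim (\<lambda>n. s n + real (k n)) at_top sequentially" and lim: "(\<lambda>n. g (k n) (s n)) \<longlonglongrightarrow> q"
    unfolding omega_limit_def by blast
  obtain r T' g' where r: "strict_mono r" and ct: "converging_trajectories H M R
      (\<lambda>n. shift_schedule T (s (r n)) (k (r n))) (\<lambda>n. shift_values g (s (r n)) (k (r n))) T' g'"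
      and omega: "\<forall>j. \<forall>t\<in>tinterval T' j. g' j t \<in> omega_limit T g"
    by (rule omega_limit_trajectory[where s = s and k = k, OF H M g s top])
  interpret converging_trajectories H M R "\<lambda>n. shift_schedule T (s (r n)) (k (r n))"
      "\<lambda>n. shift_values g (s (r n)) (k (r n))" T' g'
    by (rule ct)
  have "g' 0 0 = q"
    using LIMSEQ_subseq_LIMSEQ[OF lim r] zero_in_shift[OF trajectoryD(1)[OF g] s]
    by (intro initial_value_lim) (simp_all add: shift_values_def o_def)
  moreover have "maximal_solution H (schedule_arc T' g')"
    using trajectory_solution[OF H trajectory_lim M] by (intro complete_solution_maximal)
  ultimately have "schedule_arc T' g' \<in> solutions_from H {q}"
    by (simp add: solutions_from_def)
  then show "\<exists>x\<in>solutions_from H {q}. complete_arc x \<and> hrange x \<subseteq> omega_limit T g"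
    using trajectory_solution(2)[OF H trajectory_lim M] omega
    by (intro bexI[of _ "schedule_arc T' g'"]) (auto simp: hrange_schedule_arc)
qed

lemma solution_restrict_system:
  assumes x: "solution H x" and sub: "hrange x \<subseteq> S"
  shows "solution (restrict_system H S) x"
proof -
  have "hval x t j \<in> S" if "(t, j) \<in> hdom x" for t j
    using that sub by (auto simp: hrange_def)
  then show ?thesis
    using x unfolding solution_def restrict_system_def htimes_def by auto
qed

text \<open>The domain given by a schedule contains points with \<open>t + j\<close> arbitrarily
  large, so a property that holds eventually is indeed met beyond any bound
  \<open>B\<close>.\<close>

lemma frequently_close_in_attraction:
  assumes T: "schedule T" and e: "(0::real) < e"
    and lim: "((\<lambda>(t, j). set_dist (hval (schedule_arc T g) t j) \<Gamma>) \<longlongrightarrow> 0) (htime_at_top (schedule_arc T g))"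
  obtains t j where "t \<in> tinterval T j" "B \<le> t + real j" "set_dist (g j t) \<Gamma> < ereal e"
proof -
  have "0 < ereal e"
    using e by simp
  from order_tendstoD(2)[OF lim this]
  obtain A where A: "\<forall>(t, j)\<in>schedule_domain T. A \<le> t + real j \<longrightarrow> set_dist (g j t) \<Gamma> < ereal e"
    unfolding eventually_htime_at_top by auto
  obtain t j where "(t, j) \<in> schedule_domain T" "max A B \<le> t + real j"
    using schedule_domain_exhausts[OF T, of "max A B"] by auto
  then show thesis
    using that A by (fastforce simp: schedule_domain_def)
qed

lemma filterlim_htime_at_top:
  assumes "\<And>n. (s n, k n) \<in> hdom x" and "filterlim (\<lambda>n. s n + real (k n)) at_top sequentially"
  shows "filterlim (\<lambda>n. (s n, k n)) (htime_at_top x) sequentially"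
  using assms unfolding htime_at_top_def
  by (simp add: filterlim_inf filterlim_filtercomap_iff filterlim_principal o_def)

lemma omega_limit_subset_zero_set:
  assumes dom: "hdom x = schedule_domain T" and h: "continuous_on UNIV h"
    and lim: "((\<lambda>(t, j). h (hval x t j)) \<longlongrightarrow> 0) (htime_at_top x)"
  shows "omega_limit T (\<lambda>j t. hval x t j) \<subseteq> h -` {0::'b::real_normed_vector}"
proof
  fix q assume "q \<in> omega_limit T (\<lambda>j t. hval x t j)"
  then obtain s k where s: "\<And>n. s n \<in> tinterval T (k n)"
      and top: "filterlim (\<lambda>n. s n + real (k n)) at_top sequentially"
      and q: "(\<lambda>n. hval x (s n) (k n)) \<longlonglongrightarrow> q"
    unfolding omega_limit_def by blast
  have "filterlim (\<lambda>n. (s n, k n)) (htime_at_top x) sequentially"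
    using s top by (intro filterlim_htime_at_top) (auto simp: dom schedule_domain_def)
  from filterlim_compose[OF lim this] have "(\<lambda>n. h (hval x (s n) (k n))) \<longlonglongrightarrow> 0"
    by simp
  moreover have "(\<lambda>n. h (hval x (s n) (k n))) \<longlonglongrightarrow> h q"
    using h q by (intro continuous_on_tendsto_compose[of UNIV h]) auto
  ultimately have "h q = 0"
    using LIMSEQ_unique by blast
  then show "q \<in> h -` {0}"
    by simp
qed

section \<open>Convergence\<close>

lemma detectable_imp_convergence:
  fixes H :: "'a::euclidean_space hybrid_system" and h :: "'a \<Rightarrow> 'b::real_normed_vector"
  assumes H: "basic_assumptions H" and h: "continuous_on UNIV h" and det: "detectable H \<Gamma> h"
    and x: "solution H x" "complete_arc x" "bounded (hrange x)"
    and hx: "((\<lambda>(t, j). h (hval x t j)) \<longlongrightarrow> 0) (htime_at_top x)"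
  shows "((\<lambda>(t, j). set_dist (hval x t j) \<Gamma>) \<longlongrightarrow> 0) (htime_at_top x)"
proof -
  define g where "g = (\<lambda>j t. hval x t j)"
  obtain M R T where M: "0 \<le> M" and dom: "hdom x = schedule_domain T" and traj: "trajectory H M R T g"
    unfolding g_def by (rule complete_solution_trajectory[OF H x])
  note T = trajectoryD(1)[OF traj]
  let ?\<Omega> = "omega_limit T g"
  define \<Gamma>\<^sub>2 where "\<Gamma>\<^sub>2 = maximal_weakly_invariant_subset H (h -` {0})"
  define H\<^sub>2 where "H\<^sub>2 = restrict_system H \<Gamma>\<^sub>2"
  have "?\<Omega> \<subseteq> h -` {0}"
    using omega_limit_subset_zero_set[OF dom h hx] unfolding g_def .
  then have \<Omega>: "?\<Omega> \<subseteq> \<Gamma>\<^sub>2"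
    unfolding \<Gamma>\<^sub>2_def
    by (rule maximal_weakly_invariant_subset_greatest(3)) (rule omega_limit_weakly_forward_invariant[OF H M traj])
  have gas: "stable H\<^sub>2 \<Gamma>" "globally_attractive H\<^sub>2 \<Gamma>"
    using det unfolding detectable_def globally_asymptotically_stable_def H\<^sub>2_def \<Gamma>\<^sub>2_def by auto
  \<comment> \<open>The limits stay in \<open>?\<Omega>\<close>, hence in
    \<open>\<Gamma>\<^sub>2\<close>, and so solve the restricted system; completeness makes them
    maximal there.\<close>
  have sol2: "schedule_arc T' g' \<in> solutions_from H\<^sub>2 {g' 0 0}" "complete_arc (schedule_arc T' g')"
    if "trajectory H M R T' g'" "\<forall>j. \<forall>t\<in>tinterval T' j. g' j t \<in> ?\<Omega>" for T' g'
  proof -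
    show "complete_arc (schedule_arc T' g')"
      using trajectory_solution[OF H that(1) M] by simp
    moreover have "hrange (schedule_arc T' g') \<subseteq> \<Gamma>\<^sub>2"
      using that(2) \<Omega> by (auto simp: hrange_schedule_arc)
    then have "solution H\<^sub>2 (schedule_arc T' g')"
      unfolding H\<^sub>2_def using trajectory_solution[OF H that(1) M] by (intro solution_restrict_system)
    ultimately show "schedule_arc T' g' \<in> solutions_from H\<^sub>2 {g' 0 0}"
      using complete_solution_maximal by (simp add: solutions_from_def)
  qed
  have attr: "\<exists>j t. t \<in> tinterval T' j \<and> B \<le> t + real j \<and> set_dist (g' j t) \<Gamma> < ereal e"
    if tr: "trajectory H M R T' g'" "\<forall>j. \<forall>t\<in>tinterval T' j. g' j t \<in> ?\<Omega>" and e: "0 < e" for T' g' B e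
  proof -
    have "g' 0 0 \<in> basin_of_attraction H\<^sub>2 \<Gamma>"
      using gas(2) by (simp add: globally_attractive_def)
    then have "((\<lambda>(t, j). set_dist (hval (schedule_arc T' g') t j) \<Gamma>) \<longlongrightarrow> 0) (htime_at_top (schedule_arc T' g'))"
      using sol2[OF tr] unfolding basin_of_attraction_def by blast
    from frequently_close_in_attraction[OF trajectoryD(1)[OF tr(1)] e this, of B] show ?thesis
      by blast
  qed
  \<comment> \<open>Any sequence of hybrid times going to infinity provides one limit trajectory
    inside \<open>?\<Omega>\<close>, to which attraction applies.\<close>
  have "\<exists>s k. s \<in> tinterval T k \<and> real n \<le> s + real k" for n
    using schedule_domain_exhausts[OF T, of "real n"] by (auto simp: schedule_domain_def)
  then obtain s k where s: "\<And>n. s n \<in> tinterval T (k n)" and top: "\<And>n. real n \<le> s n + real (k n)"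
    by metis
  have at_top: "filterlim (\<lambda>n. s n + real (k n)) at_top sequentially"
    by (rule filterlim_at_top_mono[OF filterlim_real_sequentially]) (use top in auto)
  obtain r T0 g0 where "strict_mono r" and ct0: "converging_trajectories H M R
      (\<lambda>n. shift_schedule T (s (r n)) (k (r n))) (\<lambda>n. shift_values g (s (r n)) (k (r n))) T0 g0"
      and \<Omega>0: "\<forall>j. \<forall>t\<in>tinterval T0 j. g0 j t \<in> ?\<Omega>"
    by (rule omega_limit_trajectory[where s = s and k = k, OF H M traj s at_top])
  have tr0: "trajectory H M R T0 g0"
    by (rule converging_trajectories.trajectory_lim[OF ct0])
  \<comment> \<open>The distance to the empty set is infinite, so a limit trajectory that comes
    within distance 1 shows \<open>\<Gamma>\<close> to be nonempty; afterwards the real-valued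
    \<open>infdist\<close> can be used.\<close>
  obtain j0 t0 where "set_dist (g0 j0 t0) \<Gamma> < ereal 1"
    using attr[OF tr0 \<Omega>0, of 1 0] by auto
  then have ne: "\<Gamma> \<noteq> {}"
    by (auto simp: set_dist_def top_ereal_def)
  note sd = set_dist_eq_infdist[OF ne]
  \<comment> \<open>The limit trajectory comes close to \<open>\<Gamma>\<close> by attraction, and
    its values are in turn limits of values of \<open>x\<close> at arbitrarily late times.\<close>
  have near: "\<exists>t j. t \<in> tinterval T j \<and> B \<le> t + real j \<and> infdist (g j t) \<Gamma> < e" if e: "0 < e" for B e
  proof -
    obtain j t where "t \<in> tinterval T0 j" "infdist (g0 j t) \<Gamma> < e"
      using attr[OF tr0 \<Omega>0 e, of 0] by (auto simp: sd)
    then obtain s k where s: "\<And>n. s n \<in> tinterval T (k n)"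
        and top: "filterlim (\<lambda>n. s n + real (k n)) at_top sequentially"
        and lim: "(\<lambda>n. g (k n) (s n)) \<longlonglongrightarrow> g0 j t"
      using \<Omega>0 unfolding omega_limit_def by blast
    have "\<forall>\<^sub>F n in sequentially. infdist (g (k n) (s n)) \<Gamma> < e"
      using order_tendstoD(2)[OF tendsto_infdist[OF lim]] \<open>infdist (g0 j t) \<Gamma> < e\<close> .
    moreover have "\<forall>\<^sub>F n in sequentially. B \<le> s n + real (k n)"
      using top by (simp add: filterlim_at_top)
    ultimately have "\<forall>\<^sub>F n in sequentially. infdist (g (k n) (s n)) \<Gamma> < e \<and> B \<le> s n + real (k n)"
      by eventually_elim simp
    then obtain n where "infdist (g (k n) (s n)) \<Gamma> < e" "B \<le> s n + real (k n)"
      using eventually_happens'[OF sequentially_bot] by blast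
    then show ?thesis
      using s by blast
  qed
  have conv: "\<exists>B. \<forall>t j. t \<in> tinterval T j \<longrightarrow> B \<le> t + real j \<longrightarrow> infdist (g j t) \<Gamma> < e" if e: "0 < e" for e
  proof (rule ccontr)
    assume "\<not> ?thesis"
    then have far: "\<exists>t j. t \<in> tinterval T j \<and> B \<le> t + real j \<and> e \<le> infdist (g j t) \<Gamma>" for B
      by (meson not_le)
    obtain d where d: "0 < d" "reach H\<^sub>2 (dist_ball d \<Gamma>) \<subseteq> dist_ball e \<Gamma>"
      using gas(1) e unfolding stable_def by blast
    \<comment> \<open>In the limit the strict bound \<open>c\<close> on the starting distances
      weakens to a non-strict one; \<open>c < d\<close> keeps the limit's starting point in the open
      \<open>d\<close>-ball.\<close>
    define c where "c = d / 2"
    have c: "0 < c" "c < d"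
      using d(1) by (auto simp: c_def)
    text \<open>\<open>(s, k)\<close> is, up to \<open>1 / (n + 1)\<close>, the last time before \<open>(s', k')\<close> at which \<open>x\<close> is \<open>c\<close>-close to \<open>\<Gamma>\<close>.\<close>
    have "\<exists>s k s' k'. s \<in> tinterval T k \<and> s' \<in> tinterval T k' \<and> real n - 1 \<le> s + real k \<and>
        s + real k \<le> s' + real k' \<and> infdist (g k s) \<Gamma> < c \<and> e \<le> infdist (g k' s') \<Gamma> \<and>
        (\<forall>t j. t \<in> tinterval T j \<longrightarrow> s + real k + 1 / real (Suc n) \<le> t + real j \<longrightarrow> t + real j \<le> s' + real k' \<longrightarrow>
          c \<le> infdist (g j t) \<Gamma>)" for n
    proof -
      obtain t0 j0 where t0: "t0 \<in> tinterval T j0" "real n \<le> t0 + real j0" "infdist (g j0 t0) \<Gamma> < c"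
        using near[OF c(1)] by blast
      obtain s' k' where s': "s' \<in> tinterval T k'" "t0 + real j0 \<le> s' + real k'" "e \<le> infdist (g k' s') \<Gamma>"
        using far by blast
      let ?A = "{t + real j |t j. t \<in> tinterval T j \<and> t + real j \<le> s' + real k' \<and> infdist (g j t) \<Gamma> < c}"
      have A: "t0 + real j0 \<in> ?A"
        using t0 s' by blast
      have bdd: "bdd_above ?A"
        by (rule bdd_aboveI[of _ "s' + real k'"]) auto
      \<comment> \<open>The supremum need not be attained, since closeness is a strict inequality;
        hence the tolerance. As it is at most 1 and \<open>?A\<close> contains a number at least
        \<open>n\<close>, the chosen time is still at least \<open>n - 1\<close>.\<close>
      have "Sup ?A - 1 / real (Suc n) < Sup ?A"
        by simp
      then obtain a where "a \<in> ?A" "Sup ?A - 1 / real (Suc n) < a"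
        using less_cSup_iff[OF _ bdd] A by blast
      then obtain s k where s: "s \<in> tinterval T k" "s + real k \<le> s' + real k'" "infdist (g k s) \<Gamma> < c"
          "Sup ?A - 1 / real (Suc n) < s + real k"
        by blast
      have "real n - 1 \<le> s + real k"
      proof -
        have "1 / real (Suc n) \<le> 1"
          by simp
        then show ?thesis
          using cSup_upper[OF A bdd] s(4) t0(2) by linarith
      qed
      moreover have "c \<le> infdist (g j t) \<Gamma>"
        if t: "t \<in> tinterval T j" "s + real k + 1 / real (Suc n) \<le> t + real j" "t + real j \<le> s' + real k'" for t j
      proof (rule ccontr)
        assume "\<not> ?thesis"
        then have "infdist (g j t) \<Gamma> < c"
          by simp
        then have "t + real j \<in> ?A"
          using t by blast
        from cSup_upper[OF this bdd] show False
          using s(4) t(2) by linarith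
      qed
      ultimately show ?thesis
        using s s' by blast
    qed
    then obtain s k s' k' where s: "\<And>n. s n \<in> tinterval T (k n)" and s': "\<And>n. s' n \<in> tinterval T (k' n)"
        and top: "\<And>n. real n - 1 \<le> s n + real (k n)" and le: "\<And>n. s n + real (k n) \<le> s' n + real (k' n)"
        and close: "\<And>n. infdist (g (k n) (s n)) \<Gamma> < c" and away: "\<And>n. e \<le> infdist (g (k' n) (s' n)) \<Gamma>"
        and between: "\<And>n t j. t \<in> tinterval T j \<Longrightarrow> s n + real (k n) + 1 / real (Suc n) \<le> t + real j \<Longrightarrow>
          t + real j \<le> s' n + real (k' n) \<Longrightarrow> c \<le> infdist (g j t) \<Gamma>"
      by metis
    have at_top: "filterlim (\<lambda>n. s n + real (k n)) at_top sequentially"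
    proof (rule filterlim_at_top_mono)
      show "filterlim (\<lambda>n. real n - 1) at_top sequentially"
        using filterlim_tendsto_add_at_top[OF tendsto_const filterlim_real_sequentially, of "-1"] by simp
    qed (use top in auto)
    obtain r T' g' where r: "strict_mono r" and ct: "converging_trajectories H M R
        (\<lambda>n. shift_schedule T (s (r n)) (k (r n))) (\<lambda>n. shift_values g (s (r n)) (k (r n))) T' g'"
        and \<Omega>': "\<forall>j. \<forall>t\<in>tinterval T' j. g' j t \<in> ?\<Omega>"
      by (rule omega_limit_trajectory[where s = s and k = k, OF H M traj s at_top])
    interpret lim: converging_trajectories H M R "\<lambda>n. shift_schedule T (s (r n)) (k (r n))"
        "\<lambda>n. shift_values g (s (r n)) (k (r n))" T' g'
      by (rule ct)
    note shift = tinterval_shift[OF T s]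
    note tr' = lim.trajectory_lim
    have "(\<lambda>n. shift_values g (s (r n)) (k (r n)) 0 0) \<longlonglongrightarrow> g' 0 0"
      using zero_in_shift[OF T s] by (intro lim.value_lim) auto
    from tendsto_infdist[OF this] have "infdist (g' 0 0) \<Gamma> \<le> c"
      by (rule LIMSEQ_le_const2) (use close in \<open>auto simp: shift_values_def less_imp_le\<close>)
    then have "schedule_arc T' g' \<in> solutions_from H\<^sub>2 (dist_ball d \<Gamma>)"
      using sol2(1)[OF tr' \<Omega>'] c(2) by (auto simp: solutions_from_def dist_ball_def sd)
    then have "hrange (schedule_arc T' g') \<subseteq> dist_ball e \<Gamma>"
      using d(2) unfolding reach_def by blast
    then have stays: "infdist (g' j t) \<Gamma> < e" if "t \<in> tinterval T' j" for j t
      using that by (auto simp: hrange_schedule_arc dist_ball_def sd)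
    \<comment> \<open>The limit is \<open>c\<close>-close again at some hybrid time at least 1, and
      so are the shifts of \<open>x\<close> for large \<open>n\<close>, at a relative time above
      \<open>1 / 2\<close>. This exceeds the tolerance \<open>1 / real (Suc (r n))\<close>, so the
      far point must come earlier, which bounds the excursion.\<close>
    obtain j1 t1 where t1: "t1 \<in> tinterval T' j1" "1 \<le> t1 + real j1" "infdist (g' j1 t1) \<Gamma> < c"
      using attr[OF tr' \<Omega>' c(1), of 1] by (auto simp: sd)
    obtain a where a: "a \<longlonglongrightarrow> t1" "\<forall>\<^sub>F n in sequentially. a n \<in> tinterval (shift_schedule T (s (r n)) (k (r n))) j1"
      using lim.approximants[OF t1(1)] .
    have "\<forall>\<^sub>F n in sequentially. infdist (shift_values g (s (r n)) (k (r n)) j1 (a n)) \<Gamma> < c"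
      using order_tendstoD(2)[OF tendsto_infdist[OF lim.value_lim[OF a]] t1(3)] .
    moreover have "\<forall>\<^sub>F n in sequentially. t1 - 1 / 2 < a n"
      using order_tendstoD(1)[OF a(1), of "t1 - 1 / 2"] by simp
    moreover have "\<forall>\<^sub>F n in sequentially. a n < t1 + 1"
      using order_tendstoD(2)[OF a(1), of "t1 + 1"] by simp
    moreover have "\<forall>\<^sub>F n in sequentially. 1 \<le> n"
      by (rule eventually_ge_at_top)
    ultimately have "\<forall>\<^sub>F n in sequentially. s' (r n) + real (k' (r n)) < s (r n) + real (k (r n)) + (t1 + 1 + real j1)"
      using a(2)
    proof eventually_elim
      case (elim n)
      have n: "1 \<le> r n"
        using elim(4) seq_suble[OF r, of n] by simp
      then have "1 / real (Suc (r n)) \<le> 1 / 2"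
        by (simp add: field_simps)
      then have "s (r n) + real (k (r n)) + 1 / real (Suc (r n)) \<le> (s (r n) + a n) + real (k (r n) + j1)"
        using t1(2) elim(2) unfolding of_nat_add by linarith
      moreover have "s (r n) + a n \<in> tinterval T (k (r n) + j1)"
        using elim(5) shift by blast
      ultimately have "\<not> (s (r n) + a n) + real (k (r n) + j1) \<le> s' (r n) + real (k' (r n))"
        using between[of "s (r n) + a n" "k (r n) + j1" "r n"] elim(1) unfolding shift_values_def by linarith
      then show ?case
        using elim(3) by simp
    qed
    then obtain N where N: "\<And>n. N \<le> n \<Longrightarrow> s' (r n) + real (k' (r n)) < s (r n) + real (k (r n)) + (t1 + 1 + real j1)"
      unfolding eventually_sequentially by blast
    define B where "B = t1 + 1 + real j1"
    \<comment> \<open>The positions of the far points relative to the starts of the shifts lie in a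
      compact set of times and indices. Along a subsequence the times converge and the indices,
      being integers, are eventually constant.\<close>
    define b where "b n = s' (r (n + N)) - s (r (n + N))" for n
    define m where "m n = k' (r (n + N)) - k (r (n + N))" for n
    have k_le: "k (r n) \<le> k' (r n)" and s_le: "s (r n) \<le> s' (r n)" for n
      using schedule_domain_order[OF T s s' le] by auto
    have bm: "0 \<le> b n" "b n + real (m n) < B" for n
      using N[of "n + N"] k_le[of "n + N"] s_le[of "n + N"] by (auto simp: b_def m_def B_def of_nat_diff)
    have "(b n, m n) \<in> {0..B} \<times> {..nat \<lceil>B\<rceil>}" for n
    proof -
      have "b n \<le> B" "real (m n) \<le> B"
        using bm[of n] by auto
      moreover have "m n \<le> nat \<lceil>B\<rceil>"
        using \<open>real (m n) \<le> B\<close> by linarith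
      ultimately show ?thesis
        using bm(1) by simp
    qed
    moreover have "seq_compact ({0..B} \<times> {..nat \<lceil>B\<rceil>})"
      by (intro compact_imp_seq_compact compact_Times) (auto intro: finite_imp_compact)
    ultimately obtain z u where u: "strict_mono u" "((\<lambda>n. (b n, m n)) \<circ> u) \<longlonglongrightarrow> z"
      using seq_compactE[of "{0..B} \<times> {..nat \<lceil>B\<rceil>}" "\<lambda>n. (b n, m n)"] by metis
    obtain b0 m0 where z: "z = (b0, m0)"
      by (cases z)
    have b_lim: "(\<lambda>n. b (u n)) \<longlonglongrightarrow> b0" and m_lim: "(\<lambda>n. m (u n)) \<longlonglongrightarrow> m0"
      using tendsto_fst[OF u(2)] tendsto_snd[OF u(2)] by (simp_all add: z o_def)
    have m_const: "\<forall>\<^sub>F n in sequentially. m (u n) = m0"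
      using m_lim by (simp add: tendsto_discrete)
    \<comment> \<open>\<open>b\<close> and \<open>m\<close> were defined with the offset
      \<open>N\<close>; \<open>v\<close> composes it with the subsequence \<open>u\<close>, so that
      \<open>b (u n)\<close> belongs to the shift number \<open>r (v n)\<close>.\<close>
    define v where "v n = u n + N" for n
    have v: "strict_mono v"
      using u(1) by (simp add: v_def strict_mono_def)
    interpret sub: converging_trajectories H M R "\<lambda>n. shift_schedule T (s (r (v n))) (k (r (v n)))"
        "\<lambda>n. shift_values g (s (r (v n))) (k (r (v n)))" T' g'
      by (rule converging_trajectories.intro) (rule H M lim.traj schedule_converges_subseq[OF lim.conv v])+
    have b_in: "\<forall>\<^sub>F n in sequentially. b (u n) \<in> tinterval (shift_schedule T (s (r (v n))) (k (r (v n)))) m0"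
      using m_const
    proof eventually_elim
      case (elim n)
      then have "k (r (v n)) + m0 = k' (r (v n))" "s (r (v n)) + b (u n) = s' (r (v n))"
        using k_le[of "v n"] by (auto simp: m_def b_def v_def)
      then show ?case
        using bm(1) s' by (simp add: shift)
    qed
    \<comment> \<open>The far points converge to a value of the limit trajectory, and the non-strict
      bound from below survives; this contradicts \<open>stays\<close>.\<close>
    have "e \<le> infdist (g' m0 b0) \<Gamma>"
    proof (rule tendsto_lowerbound[OF tendsto_infdist[OF sub.value_lim[OF b_lim b_in]]])
      show "\<forall>\<^sub>F n in sequentially. e \<le> infdist (shift_values g (s (r (v n))) (k (r (v n))) m0 (b (u n))) \<Gamma>"
        using m_const
      proof eventually_elim
        case (elim n)
        then have "k (r (v n)) + m0 = k' (r (v n))" "s (r (v n)) + b (u n) = s' (r (v n))"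
          using k_le[of "v n"] by (auto simp: m_def b_def v_def)
        then show ?case
          using away by (simp add: shift_values_def)
      qed
    qed simp
    then show False
      using stays[OF sub.tinterval_lim[OF b_lim b_in]] by simp
  qed
  show ?thesis
  proof (rule order_tendstoI)
    fix l :: ereal assume "l < 0"
    have "l < set_dist (hval x t j) \<Gamma>" for t j
      using \<open>l < 0\<close> by (simp add: sd less_le_trans infdist_nonneg)
    then show "\<forall>\<^sub>F z in htime_at_top x. l < (case z of (t, j) \<Rightarrow> set_dist (hval x t j) \<Gamma>)"
      by (intro always_eventually) auto
  next
    fix l :: ereal assume "0 < l"
    then obtain e where e: "0 < ereal e" "ereal e < l"
      using ereal_dense2 by blast
    then obtain B where "\<And>t j. t \<in> tinterval T j \<Longrightarrow> B \<le> t + real j \<Longrightarrow> infdist (g j t) \<Gamma> < e"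
      using conv[of e] by auto
    then have "\<forall>(t, j)\<in>hdom x. B \<le> t + real j \<longrightarrow> set_dist (hval x t j) \<Gamma> < l"
      using less_trans[OF _ e(2)] by (auto simp: dom schedule_domain_def sd g_def)
    then show "\<forall>\<^sub>F z in htime_at_top x. (case z of (t, j) \<Rightarrow> set_dist (hval x t j) \<Gamma>) < l"
      unfolding eventually_htime_at_top by auto
  qed
qed

theorem mainTheorem6:
  fixes H :: "(real ^ 'n) hybrid_system"
    and h :: "real ^ 'n \<Rightarrow> real ^ 'k"
    and \<Gamma>\<^sub>1 :: "(real ^ 'n) set"
  assumes "basic_assumptions H"
    and "continuous_on UNIV h"
    and "\<Gamma>\<^sub>1 \<subseteq> h -` {0}"
    and "compact \<Gamma>\<^sub>1"
    and "strongly_forward_invariant H \<Gamma>\<^sub>1"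
    and "\<forall>x\<in>solutions_from H \<Gamma>\<^sub>1. complete_arc x"
    and "detectable H \<Gamma>\<^sub>1 h"
    and "\<forall>x\<in>solutions_from H UNIV. bounded (hrange x)"
    and "\<forall>x\<in>solutions_from H UNIV. complete_arc x \<longrightarrow>
           ((\<lambda>(t, j). h (hval x t j)) \<longlongrightarrow> 0) (htime_at_top x)"
  shows "globally_attractive H \<Gamma>\<^sub>1"
proof -
  have "p \<in> basin_of_attraction H \<Gamma>\<^sub>1" for p
    unfolding basin_of_attraction_def
  proof (intro CollectI ballI conjI impI)
    fix x assume x: "x \<in> solutions_from H {p}"
    then have UNIV: "x \<in> solutions_from H UNIV" and sol: "solution H x"
      by (auto simp: solutions_from_def maximal_solution_def)
    then show bounded: "bounded (hrange x)"
      using assms(8) by blast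
    assume "complete_arc x"
    then show "((\<lambda>(t, j). set_dist (hval x t j) \<Gamma>\<^sub>1) \<longlongrightarrow> 0) (htime_at_top x)"
      using detectable_imp_convergence[OF assms(1,2,7) sol _ bounded] assms(9) UNIV by blast
  qed
  then show ?thesis
    unfolding globally_attractive_def by blast
qed

end
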